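(* Assume $\mu=\mu_f+\mu_\Psi>0$. Let the Enhanced Accelerated Composite Gradient Method (described in the context) be run with $A_0=0$, $\gamma_0=1$ and constant dampening parameters $\alpha_k=\alpha\in[0,1]$ for all $k\ge0$, and suppose the estimate sequence property $A_kF(x_k)\le\psi_k^*$ is maintained for all $k\ge0$; this is the case in particular if either (a) all Lipschitz estimates satisfy $L_k\ge L_l$ with $L_l>0$, $q_l=\mu/(L_l+\mu_\Psi)\le1/3$ and $0\le\alpha\le\alpha_{\max}(q_l)$, or (b) $\alpha=0.7542$. Then for all $k\ge1$ $$\|v_k-x^*\|^2\le\frac{L_u-\mu_f}{\mu(1+\alpha)}\left(1-r(q_u,\alpha)\sqrt{q_u}\right)^{k-1}\|x_0-x^*\|^2,$$ where $L_u=\max\{r_dL_0,r_uL_f\}$, $q_u=\mu/(L_u+\mu_\Psi)$ and $r(q,\alpha)=\sqrt{(1+\alpha)(1+q\alpha)}-\sqrt q\,\alpha$.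
   Context: $\mathbb E$ is a finite-dimensional real vector space with dual $\mathbb E^*$, $\langle g,x\rangle$ is the value of $g\in\mathbb E^*$ at $x\in\mathbb E$, $B:\mathbb E\to\mathbb E^*$ is self-adjoint positive definite, $\|x\|=\sqrt{\langle Bx,x\rangle}$, $\|g\|_*=\sqrt{\langle g,B^{-1}g\rangle}$. Objective: $F=f+\Psi$, where $f:\mathbb E\to\mathbb R$ is differentiable with $L_f$-Lipschitz gradient ($L_f>0$) and $f-\frac{\mu_f}2\|\cdot\|^2$ is convex, $\mu_f\ge0$; $\Psi:\mathbb E\to\mathbb R\cup\{+\infty\}$ is proper, lower semicontinuous and $\Psi-\frac{\mu_\Psi}2\|\cdot\|^2$ is convex, $\mu_\Psi\ge0$. $\mu=\mu_f+\mu_\Psi$. $x^*$ is a minimizer of $F$ (assumed to exist). For $L>0$, $T_L(z)=\arg\min_x\{f(z)+\langle f'(z),x-z\rangle+\frac L2\|x-z\|^2+\Psi(x)\}$. Enhanced Accelerated Composite Gradient Method. Input: $x_0\in\mathbb E$, $L_0>0$, $0\le L_l\le L_u$, $r_u>1$, $r_d\in(0,1]$, parameters $\alpha_k\in[0,1]$. Set $v_0=x_0$, $A_0=0$, $\gamma_0=1$. For $k=0,1,\dots$: start with $L_{k+1}=\max\{L_l,r_dL_k\}$ and, as long as the descent test in the last step below fails, multiply $L_{k+1}$ by $r_u$ and recompute: $\bar L_{k+1}=L_{k+1}+\mu_\Psi$, $q_{k+1}=\mu/\bar L_{k+1}$, $\tilde\gamma_k=\gamma_k+\mu(1-\alpha_k)A_k$,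 $\bar\beta_{k+1}=\frac{\alpha_{k+1}}{1+q_{k+1}\alpha_{k+1}}-\alpha_k$; $a_{k+1}=\frac{1}{2(\bar L_{k+1}-\mu)}\left(\tilde\gamma_k+\sqrt{\tilde\gamma_k^2+4(\bar L_{k+1}-\mu)A_k(\gamma_k+\mu\bar\beta_{k+1}A_k)}\right)$; $A_{k+1}=A_k+a_{k+1}$; $\bar a_{k+1}=a_{k+1}+q_{k+1}\alpha_{k+1}A_{k+1}$; $\gamma_{k+1}=\gamma_k+\mu(a_{k+1}+\alpha_{k+1}A_{k+1}-\alpha_kA_k)$; $\bar\gamma_{k+1}=\gamma_{k+1}-\mu\alpha_k\bar a_{k+1}$; $y_{k+1}=(A_k\bar\gamma_{k+1}+\bar a_{k+1}\gamma_k)^{-1}(A_k\bar\gamma_{k+1}x_k+\bar a_{k+1}\gamma_kv_k)$; $x_{k+1}=T_{L_{k+1}}(y_{k+1})$; descent test: $f(x_{k+1})\le f(y_{k+1})+\langle f'(y_{k+1}),x_{k+1}-y_{k+1}\rangle+\frac{L_{k+1}}2\|x_{k+1}-y_{k+1}\|^2$. Once it passes, set $g_{k+1}=\bar L_{k+1}B(y_{k+1}-x_{k+1})$ and $v_{k+1}=\frac{\gamma_k}{\bar\gamma_{k+1}}v_k+\left(1-\frac{\gamma_k}{\bar\gamma_{k+1}}\right)y_{k+1}-\frac{\bar a_{k+1}}{\gamma_{k+1}}B^{-1}g_{k+1}$. All Lipschitz estimates used are assumed to satisfy $L_k>\mu_f$, so that $\bar L_k-\mu>0$. Estimate functions (with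 the convention $A_0F(x_0)=0$ since $A_0=0$): $\psi_k(x)=\sum_{i=1}^ka_iw_i(x)+A_k\frac{\mu\alpha_k}2\|x-x_k\|^2+\frac{\gamma_0}2\|x-x_0\|^2$, where $w_i(x)=F(x_i)+\frac1{2\bar L_i}\|g_i\|_*^2+\langle g_i,x-y_i\rangle+\frac\mu2\|x-y_i\|^2$; $\psi_k^*=\min_x\psi_k(x)$. For $q\in[0,1/3]$, $\alpha_{\max}(q)$ is the $\alpha\in[0,1]$ with $\delta(q,\alpha)=0$, where $\delta(q,\alpha)=(1-\alpha)\sqrt{(1+\alpha)(1+q\alpha)}-\sqrt q\,\alpha(1-q\alpha^2)$. *)

theory Defs
  imports "HOL-Analysis.Analysis"
begin

text \<open>
  The vector space is a type of class \<open>euclidean_space\<close>, of which only the vector space and its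
  topology are used; its built-in inner product and norm play no role.
  The dual space is the type of bounded linear functionals, and \<open>g x\<close> is the pairing of \<open>g\<close>
  and \<open>x\<close> (through the coercion \<^const>\<open>blinfun_apply\<close>).
\<close>

definition spd_operator :: "('a::euclidean_space \<Rightarrow> 'a \<Rightarrow>\<^sub>L real) \<Rightarrow> bool" where
  "spd_operator B \<longleftrightarrow>
     linear B \<and> (\<forall>x y. B x y = B y x) \<and> (\<forall>x. x \<noteq> 0 \<longrightarrow> 0 < B x x)"

definition primal_norm :: "('a::euclidean_space \<Rightarrow> 'a \<Rightarrow>\<^sub>L real) \<Rightarrow> 'a \<Rightarrow> real" where
  "primal_norm B x = sqrt (B x x)"

definition dual_norm :: "('a::euclidean_space \<Rightarrow> 'a \<Rightarrow>\<^sub>L real) \<Rightarrow> ('a \<Rightarrow>\<^sub>L real) \<Rightarrow> real" where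
  "dual_norm B g = sqrt (g (inv B g))"

definition proper_ext :: "('a \<Rightarrow> ereal) \<Rightarrow> bool" where
  "proper_ext \<phi> \<longleftrightarrow> (\<forall>x. \<phi> x \<noteq> -\<infinity>) \<and> (\<exists>x. \<phi> x \<noteq> \<infinity>)"

definition lsc :: "('a::topological_space \<Rightarrow> ereal) \<Rightarrow> bool" where
  "lsc \<phi> \<longleftrightarrow> (\<forall>x. \<phi> x \<le> Liminf (at x) \<phi>)"

text \<open>
  For functions that avoid \<open>-\<infinity>\<close>. At \<open>t = 0\<close> and \<open>t = 1\<close> the inequality is trivial, because
  \<open>0 * \<infinity> = 0\<close> in \<^typ>\<open>ereal\<close>.
\<close>

definition convex_ext :: "('a::real_vector \<Rightarrow> ereal) \<Rightarrow> bool" where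
  "convex_ext \<phi> \<longleftrightarrow>
     (\<forall>x y. \<forall>t\<in>{0..1}. \<phi> ((1 - t) *\<^sub>R x + t *\<^sub>R y) \<le> ereal (1 - t) * \<phi> x + ereal t * \<phi> y)"

definition objective :: "('a \<Rightarrow> real) \<Rightarrow> ('a \<Rightarrow> ereal) \<Rightarrow> 'a \<Rightarrow> ereal" where
  "objective f \<Psi> x = ereal (f x) + \<Psi> x"

definition prox_model ::
  "('a::euclidean_space \<Rightarrow> 'a \<Rightarrow>\<^sub>L real) \<Rightarrow> ('a \<Rightarrow> real) \<Rightarrow> ('a \<Rightarrow> 'a \<Rightarrow>\<^sub>L real) \<Rightarrow> ('a \<Rightarrow> ereal)
    \<Rightarrow> real \<Rightarrow> 'a \<Rightarrow> 'a \<Rightarrow> ereal" where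
  "prox_model B f f' \<Psi> L z x =
     ereal (f z + f' z (x - z) + L / 2 * (primal_norm B (x - z))\<^sup>2) + \<Psi> x"

definition prox_grad ::
  "('a::euclidean_space \<Rightarrow> 'a \<Rightarrow>\<^sub>L real) \<Rightarrow> ('a \<Rightarrow> real) \<Rightarrow> ('a \<Rightarrow> 'a \<Rightarrow>\<^sub>L real) \<Rightarrow> ('a \<Rightarrow> ereal)
    \<Rightarrow> real \<Rightarrow> 'a \<Rightarrow> 'a" where
  "prox_grad B f f' \<Psi> L z = arg_min (prox_model B f f' \<Psi> L z) (\<lambda>x. True)"

definition descent_test ::
  "('a::euclidean_space \<Rightarrow> 'a \<Rightarrow>\<^sub>L real) \<Rightarrow> ('a \<Rightarrow> real) \<Rightarrow> ('a \<Rightarrow> 'a \<Rightarrow>\<^sub>L real)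
    \<Rightarrow> real \<Rightarrow> 'a \<Rightarrow> 'a \<Rightarrow> bool" where
  "descent_test B f f' L y x \<longleftrightarrow>
     f x \<le> f y + f' y (x - y) + L / 2 * (primal_norm B (x - y))\<^sup>2"

definition comp_gradient ::
  "('a::euclidean_space \<Rightarrow> 'a \<Rightarrow>\<^sub>L real) \<Rightarrow> real \<Rightarrow> real \<Rightarrow> 'a \<Rightarrow> 'a \<Rightarrow> ('a \<Rightarrow>\<^sub>L real)" where
  "comp_gradient B \<mu>\<Psi> L y x = (L + \<mu>\<Psi>) *\<^sub>R B (y - x)"

record 'a trial =
  tr_a :: real
  tr_A :: real
  tr_abar :: real
  tr_gamma :: real
  tr_gammabar :: real
  tr_y :: 'a
  tr_x :: 'a

text \<open>
  Here \<open>\<alpha>\<close>, \<open>A\<close>, \<open>\<gamma>\<close>, \<open>x\<close>, \<open>v\<close> carry the index \<open>k\<close>, whereas \<open>\<alpha>'\<close> and the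
  candidate estimate \<open>L\<close> carry the index \<open>k + 1\<close>.
\<close>

definition eacgm_trial ::
  "('a::euclidean_space \<Rightarrow> 'a \<Rightarrow>\<^sub>L real) \<Rightarrow> ('a \<Rightarrow> real) \<Rightarrow> ('a \<Rightarrow> 'a \<Rightarrow>\<^sub>L real) \<Rightarrow> ('a \<Rightarrow> ereal)
    \<Rightarrow> real \<Rightarrow> real \<Rightarrow> real \<Rightarrow> real \<Rightarrow> real \<Rightarrow> real \<Rightarrow> 'a \<Rightarrow> 'a \<Rightarrow> real \<Rightarrow> 'a trial" where
  "eacgm_trial B f f' \<Psi> \<mu>f \<mu>\<Psi> \<alpha> \<alpha>' A \<gamma> x v L =
    (let \<mu> = \<mu>f + \<mu>\<Psi>;
         Lbar = L + \<mu>\<Psi>;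
         q = \<mu> / Lbar;
         \<gamma>tilde = \<gamma> + \<mu> * (1 - \<alpha>) * A;
         \<beta>bar = \<alpha>' / (1 + q * \<alpha>') - \<alpha>;
         a' = 1 / (2 * (Lbar - \<mu>)) *
              (\<gamma>tilde + sqrt (\<gamma>tilde\<^sup>2 + 4 * (Lbar - \<mu>) * A * (\<gamma> + \<mu> * \<beta>bar * A)));
         A' = A + a';
         abar = a' + q * \<alpha>' * A';
         \<gamma>' = \<gamma> + \<mu> * (a' + \<alpha>' * A' - \<alpha> * A);
         \<gamma>bar = \<gamma>' - \<mu> * \<alpha> * abar;
         y' = inverse (A * \<gamma>bar + abar * \<gamma>) *\<^sub>R ((A * \<gamma>bar) *\<^sub>R x + (abar * \<gamma>) *\<^sub>R v)
     in \<lparr> tr_a = a', tr_A = A', tr_abar = abar, tr_gamma = \<gamma>', tr_gammabar = \<gamma>bar,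
          tr_y = y', tr_x = prox_grad B f f' \<Psi> L y' \<rparr>)"

text \<open>
  The sequences generated by the method, started at \<open>x 0\<close> with initial estimate \<open>L 0\<close>; the
  entries \<open>a 0\<close> and \<open>y 0\<close> are meaningless. The accepted estimate is the first one in
  \<open>s, r\<^sub>u * s, r\<^sub>u\<^sup>2 * s, \<dots>\<close>, for \<open>s = max L\<^sub>l (r\<^sub>d * L k)\<close>, that passes the descent test.
\<close>

definition eacgm_run ::
  "('a::euclidean_space \<Rightarrow> 'a \<Rightarrow>\<^sub>L real) \<Rightarrow> ('a \<Rightarrow> real) \<Rightarrow> ('a \<Rightarrow> 'a \<Rightarrow>\<^sub>L real) \<Rightarrow> ('a \<Rightarrow> ereal)
    \<Rightarrow> real \<Rightarrow> real \<Rightarrow> real \<Rightarrow> real \<Rightarrow> real \<Rightarrow> (nat \<Rightarrow> real)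
    \<Rightarrow> (nat \<Rightarrow> real) \<Rightarrow> (nat \<Rightarrow> real) \<Rightarrow> (nat \<Rightarrow> real) \<Rightarrow> (nat \<Rightarrow> real)
    \<Rightarrow> (nat \<Rightarrow> 'a) \<Rightarrow> (nat \<Rightarrow> 'a) \<Rightarrow> (nat \<Rightarrow> 'a) \<Rightarrow> bool" where
  "eacgm_run B f f' \<Psi> \<mu>f \<mu>\<Psi> Ll ru rd \<alpha> L A a \<gamma> x y v \<longleftrightarrow>
     A 0 = 0 \<and> \<gamma> 0 = 1 \<and> v 0 = x 0 \<and>
     (\<forall>k. let tr = eacgm_trial B f f' \<Psi> \<mu>f \<mu>\<Psi> (\<alpha> k) (\<alpha> (Suc k)) (A k) (\<gamma> k) (x k) (v k);
              passes = (\<lambda>l. descent_test B f f' l (tr_y (tr l)) (tr_x (tr l)));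
              s = max Ll (rd * L k);
              t = tr (L (Suc k))
          in (\<exists>i. L (Suc k) = ru ^ i * s \<and> passes (ru ^ i * s) \<and> (\<forall>j<i. \<not> passes (ru ^ j * s))) \<and>
             a (Suc k) = tr_a t \<and> A (Suc k) = tr_A t \<and> \<gamma> (Suc k) = tr_gamma t \<and>
             y (Suc k) = tr_y t \<and> x (Suc k) = tr_x t \<and>
             v (Suc k) = (\<gamma> k / tr_gammabar t) *\<^sub>R v k
               + (1 - \<gamma> k / tr_gammabar t) *\<^sub>R y (Suc k)
               - (tr_abar t / \<gamma> (Suc k)) *\<^sub>R
                   inv B (comp_gradient B \<mu>\<Psi> (L (Suc k)) (y (Suc k)) (x (Suc k))))"

definition lower_bound_fun ::
  "('a::euclidean_space \<Rightarrow> 'a \<Rightarrow>\<^sub>L real) \<Rightarrow> ('a \<Rightarrow> ereal) \<Rightarrow> real \<Rightarrow> real \<Rightarrow> real \<Rightarrow> 'a \<Rightarrow> 'a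
    \<Rightarrow> 'a \<Rightarrow> ereal" where
  "lower_bound_fun B F \<mu>f \<mu>\<Psi> Li xi yi z =
    (let g = comp_gradient B \<mu>\<Psi> Li yi xi
     in F xi + ereal (1 / (2 * (Li + \<mu>\<Psi>)) * (dual_norm B g)\<^sup>2 + g (z - yi)
                      + (\<mu>f + \<mu>\<Psi>) / 2 * (primal_norm B (z - yi))\<^sup>2))"

definition estimate_fun ::
  "('a::euclidean_space \<Rightarrow> 'a \<Rightarrow>\<^sub>L real) \<Rightarrow> ('a \<Rightarrow> ereal) \<Rightarrow> real \<Rightarrow> real \<Rightarrow> (nat \<Rightarrow> real)
    \<Rightarrow> (nat \<Rightarrow> real) \<Rightarrow> (nat \<Rightarrow> real) \<Rightarrow> (nat \<Rightarrow> real) \<Rightarrow> (nat \<Rightarrow> real)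
    \<Rightarrow> (nat \<Rightarrow> 'a) \<Rightarrow> (nat \<Rightarrow> 'a) \<Rightarrow> nat \<Rightarrow> 'a \<Rightarrow> ereal" where
  "estimate_fun B F \<mu>f \<mu>\<Psi> \<alpha> L A a \<gamma> x y k z =
     (\<Sum>i=1..k. ereal (a i) * lower_bound_fun B F \<mu>f \<mu>\<Psi> (L i) (x i) (y i) z)
     + ereal (A k * ((\<mu>f + \<mu>\<Psi>) * \<alpha> k / 2) * (primal_norm B (z - x k))\<^sup>2
              + \<gamma> 0 / 2 * (primal_norm B (z - x 0))\<^sup>2)"

text \<open>
  The value \<open>F (x 0)\<close> may be infinite; since \<open>0 * \<infinity> = 0\<close> in \<^typ>\<open>ereal\<close>, the term \<open>A 0 * F (x 0)\<close>
  is zero as \<open>A 0 = 0\<close>. The infimum of the strongly convex estimate function is its minimum.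
\<close>

definition estimate_property ::
  "('a::euclidean_space \<Rightarrow> 'a \<Rightarrow>\<^sub>L real) \<Rightarrow> ('a \<Rightarrow> ereal) \<Rightarrow> real \<Rightarrow> real \<Rightarrow> (nat \<Rightarrow> real)
    \<Rightarrow> (nat \<Rightarrow> real) \<Rightarrow> (nat \<Rightarrow> real) \<Rightarrow> (nat \<Rightarrow> real) \<Rightarrow> (nat \<Rightarrow> real)
    \<Rightarrow> (nat \<Rightarrow> 'a) \<Rightarrow> (nat \<Rightarrow> 'a) \<Rightarrow> bool" where
  "estimate_property B F \<mu>f \<mu>\<Psi> \<alpha> L A a \<gamma> x y \<longleftrightarrow>
     (\<forall>k. ereal (A k) * F (x k) \<le> (INF z. estimate_fun B F \<mu>f \<mu>\<Psi> \<alpha> L A a \<gamma> x y k z))"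

definition delta_fun :: "real \<Rightarrow> real \<Rightarrow> real" where
  "delta_fun q \<alpha> = (1 - \<alpha>) * sqrt ((1 + \<alpha>) * (1 + q * \<alpha>)) - sqrt q * \<alpha> * (1 - q * \<alpha>\<^sup>2)"

text \<open>The root is unique for \<open>0 \<le> q \<le> 1/3\<close>, the only range in which it is used.\<close>

definition alpha_max :: "real \<Rightarrow> real" where
  "alpha_max q = (THE \<alpha>. \<alpha> \<in> {0..1} \<and> delta_fun q \<alpha> = 0)"

definition rate :: "real \<Rightarrow> real \<Rightarrow> real" where
  "rate q \<alpha> = sqrt ((1 + \<alpha>) * (1 + q * \<alpha>)) - sqrt q * \<alpha>"

end

theory Submission
  imports Defs
begin

text \<open>
  Write \<open>N u\<close> for the squared norm of \<open>u\<close> and \<open>F\<close> for the objective. Each proximal step yields a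
  lower model \<open>w\<close> of \<open>F\<close>, a quadratic of curvature \<open>\<mu>\<close> (\<open>objective_lower_bound\<close>), so every
  estimate function is a quadratic of curvature \<open>\<gamma> k = 1 + \<mu> * (1 + \<alpha>) * A k\<close>, and the points \<open>v k\<close>
  of the method are the minimizers of these quadratics (\<open>estimate_canonical\<close>).

  Rate. Assume the estimate sequence property and evaluate the \<open>k\<close>-th estimate function at \<open>xstar\<close>. On
  one side it is at least \<open>A k * F (x k) + \<gamma> k / 2 * N (v k - xstar)\<close>; on the other side the lower
  models bound it by \<open>A k * F xstar\<close> plus half of \<open>N (x 0 - xstar)\<close> plus
  \<open>A k * \<mu> * \<alpha> / 2 * N (x k - xstar)\<close>. Strong convexity of \<open>F\<close> at its minimizer absorbs the last
  term, which leaves \<open>\<gamma> k * N (v k - xstar) \<le> N (x 0 - xstar)\<close>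
  (\<open>distance_if_estimate_property\<close>). It remains to see that \<open>A k\<close> grows geometrically: the equation
  defining the weight \<open>a\<close> implies \<open>t\<^sup>2 + 2 q \<alpha> t \<ge> q (1 + \<alpha> + q \<alpha>)\<close> for the ratio \<open>t\<close> of \<open>a\<close> to
  the new \<open>A\<close>, and the positive root of this quadratic is \<open>rate q \<alpha> * sqrt q\<close>, which increases with
  \<open>q\<close> as long as it stays below one (\<open>ratio_quadratic\<close>, \<open>rate_times_sqrt_le\<close>, \<open>A_growth\<close>). The line
  search never accepts an estimate above \<open>Lu\<close> (\<open>L_le_Lu\<close>), so \<open>q\<close> is at least \<open>qu\<close> in every step.

  Estimate sequence property. By induction: bound \<open>F (x k)\<close> from below by the new lower model at
  \<open>x k\<close> and complete the square in the next estimate function. The parameters of the method are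
  tuned so that all terms cancel except a multiple of \<open>N (x k - y (k + 1))\<close>
  (\<open>estimate_increment_nonneg\<close>), and that multiple is nonnegative as soon as \<open>progress_margin q \<alpha>\<close> is
  (\<open>residual_weight_nonneg\<close>). This margin is an elementary function of two real variables. It is
  nonnegative for all \<open>q \<le> ql \<le> 1 / 3\<close> whenever \<open>\<alpha> \<le> alpha_max ql\<close>, because \<open>delta_fun ql\<close> is strictly
  decreasing and hence nonnegative up to its unique zero, and for all \<open>q \<le> 1\<close> when
  \<open>2 * \<alpha>\<^sup>2 + \<alpha> \<le> 2\<close>, which covers \<open>\<alpha> = 0.7542\<close>.
\<close>

text \<open>
  The source of every first-order condition below: an inequality along a segment is divided by the
  step length \<open>t\<close>, and \<open>t\<close> tends to zero.
\<close>

lemma linear_term_nonneg: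
  fixes c d :: real
  assumes "\<And>t. 0 < t \<Longrightarrow> t \<le> 1 \<Longrightarrow> 0 \<le> t * c + t\<^sup>2 * d"
  shows "0 \<le> c"
proof (rule tendsto_lowerbound)
  show "((\<lambda>t. c + t * d) \<longlongrightarrow> c) (at_right 0)"
    by (auto intro!: tendsto_eq_intros)
  have "0 \<le> c + t * d" if "0 < t" "t < 1" for t
  proof -
    have "0 \<le> t * (c + t * d)"
      using assms[of t] that by (simp add: algebra_simps power2_eq_square)
    then show ?thesis using that by (simp add: zero_le_mult_iff)
  qed
  then show "\<forall>\<^sub>F t in at_right 0. 0 \<le> c + t * d"
    by (auto simp: eventually_at_right_field intro!: exI[of _ 1])
qed simp

section \<open>Geometry of a positive definite operator\<close>

locale spd_form =
  fixes B :: "'a::euclidean_space \<Rightarrow> 'a \<Rightarrow>\<^sub>L real"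
  assumes spd: "spd_operator B"
begin

definition ip :: "'a \<Rightarrow> 'a \<Rightarrow> real"
  where "ip x y = B x y"

lemma linear_B: "linear B"
  using spd by (simp add: spd_operator_def)

lemma ip_commute: "ip x y = ip y x"
  using spd by (simp add: spd_operator_def ip_def)

lemma ip_pos: "x \<noteq> 0 \<Longrightarrow> 0 < ip x x"
  using spd by (simp add: spd_operator_def ip_def)

lemma ip_expand:
  "ip (x + y) z = ip x z + ip y z" "ip z (x + y) = ip z x + ip z y"
  "ip (x - y) z = ip x z - ip y z" "ip z (x - y) = ip z x - ip z y"
  "ip (- x) z = - ip x z" "ip z (- x) = - ip z x"
  "ip (c *\<^sub>R x) z = c * ip x z" "ip z (c *\<^sub>R x) = c * ip z x"
  "ip 0 z = 0" "ip z 0 = 0"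
  using linear_B
  by (simp_all add: ip_def linear_add linear_diff linear_neg linear_scale linear_0
      blinfun.bilinear_simps)

lemma ip_convex_combination:
  "ip (x + t *\<^sub>R (w - x)) (x + t *\<^sub>R (w - x))
    = (1 - t) * ip x x + t * ip w w - t * (1 - t) * ip (w - x) (w - x)"
  by (simp add: ip_expand ip_commute[of w x] algebra_simps power2_eq_square)

lemma ip_nonneg: "0 \<le> ip x x"
  using ip_pos[of x] by (cases "x = 0") (auto simp: ip_expand)

lemma primal_norm_sq: "(primal_norm B x)\<^sup>2 = ip x x"
  using ip_nonneg[of x] by (simp add: primal_norm_def ip_def)

lemma ip_Cauchy_Schwarz: "ip x y \<le> sqrt (ip x x) * sqrt (ip y y)"
proof (cases "y = 0")
  case False
  define r where "r = ip x y / ip y y"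
  have pos: "0 < ip y y" by (rule ip_pos[OF False])
  have "0 \<le> ip (x - r *\<^sub>R y) (x - r *\<^sub>R y)" by (rule ip_nonneg)
  also have "\<dots> = ip x x - 2 * r * ip x y + r\<^sup>2 * ip y y"
    by (simp add: ip_expand ip_commute[of y x] power2_eq_square algebra_simps)
  also have "\<dots> = ip x x - (ip x y)\<^sup>2 / ip y y"
    using pos by (simp add: r_def power2_eq_square field_simps)
  finally have "(ip x y)\<^sup>2 \<le> ip x x * ip y y"
    using pos by (simp add: field_simps)
  then show ?thesis
    by (metis real_le_rsqrt real_sqrt_mult)
qed (simp add: ip_expand)

text \<open>
  Only surjectivity needs work. The Riesz representation with respect to the ambient inner product
  turns \<open>B\<close> into an endomorphism \<open>M\<close>, and in finite dimension an injective endomorphism is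
  surjective.
\<close>

lemma bij_B: "bij B"
proof -
  have inj: "inj B"
    using linear_B
  proof (rule linear_injective_0[THEN iffD2], intro allI impI)
    fix x assume "B x = 0"
    then have "ip x x = 0" by (simp add: ip_def)
    then show "x = 0" using ip_pos[of x] by fastforce
  qed
  define M where "M x = (\<Sum>b\<in>Basis. ip x b *\<^sub>R b)" for x
  have M_inner: "M x \<bullet> u = ip x u" for x u
  proof -
    have "ip x u = ip x (\<Sum>b\<in>Basis. (u \<bullet> b) *\<^sub>R b)" by (simp add: euclidean_representation)
    also have "\<dots> = (\<Sum>b\<in>Basis. (u \<bullet> b) * ip x b)"
      by (simp add: ip_def blinfun.sum_right blinfun.scaleR_right)
    finally show ?thesis
      by (simp add: M_def inner_sum_left inner_commute[of u] mult.commute)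
  qed
  have "linear M"
    by (rule linearI) (simp_all add: M_def ip_expand scaleR_add_left sum.distrib scaleR_sum_right)
  moreover have "inj M"
    using \<open>linear M\<close>
  proof (rule linear_injective_0[THEN iffD2], intro allI impI)
    fix x assume "M x = 0"
    then have "ip x x = 0" by (simp flip: M_inner)
    then show "x = 0" using ip_pos[of x] by fastforce
  qed
  ultimately have "surj M"
    by (rule linear_injective_imp_surjective) simp
  have "surj B"
  proof (rule surjI)
    fix g :: "'a \<Rightarrow>\<^sub>L real"
    define w where "w = (\<Sum>b\<in>Basis. g b *\<^sub>R b)"
    have w: "g u = w \<bullet> u" for u
    proof -
      have "g u = g (\<Sum>b\<in>Basis. (u \<bullet> b) *\<^sub>R b)" by (simp add: euclidean_representation)
      also have "\<dots> = (\<Sum>b\<in>Basis. (u \<bullet> b) * g b)"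
        by (simp add: blinfun.sum_right blinfun.scaleR_right)
      finally show ?thesis
        by (simp add: w_def inner_sum_left inner_commute[of u] mult.commute)
    qed
    have "M (inv M w) = w" using \<open>surj M\<close> by (rule surj_f_inv_f)
    then have "B (inv M w) = g"
      by (intro blinfun_eqI) (simp add: w flip: ip_def M_inner)
    then show "B (inv M (\<Sum>b\<in>Basis. g b *\<^sub>R b)) = g"
      by (simp only: w_def)
  qed
  with inj show ?thesis by (rule bijI)
qed

lemma inv_B_B [simp]: "inv B (B x) = x"
  using bij_B by (simp add: bij_is_inj)

lemma B_inv_B [simp]: "B (inv B g) = g"
  using bij_B by (simp add: bij_is_surj surj_f_inv_f)

lemma apply_le_norms: "blinfun_apply g x \<le> dual_norm B g * primal_norm B x"
  using ip_Cauchy_Schwarz[of "inv B g" x] by (simp add: dual_norm_def primal_norm_def ip_def)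

lemma continuous_ip_diag: "continuous_on S (\<lambda>z. ip (z - w) (z - w))"
proof -
  have "continuous_on S (\<lambda>z. B (z - w))"
    by (rule linear_continuous_on_compose[OF _ linear_B]) (intro continuous_intros)
  then show ?thesis
    unfolding ip_def by (rule bounded_bilinear.continuous_on[OF bounded_bilinear_blinfun_apply]) (intro continuous_intros)
qed

text \<open>
  Compactness of the ambient unit sphere; this is the only place where the two norms are compared.
\<close>

lemma ip_coercive: "\<exists>m>0. \<forall>x. m * (norm x)\<^sup>2 \<le> ip x x"
proof (cases "\<exists>b::'a. norm b = 1")
  case True
  let ?S = "sphere (0::'a) 1"
  have "?S \<noteq> {}" using True by auto
  then obtain u where u: "u \<in> ?S" "\<And>z. z \<in> ?S \<Longrightarrow> ip u u \<le> ip z z"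
    using continuous_attains_inf[OF compact_sphere, of 0 1 "\<lambda>z. ip z z"]
      continuous_ip_diag[of ?S 0] by auto
  have "ip u u * (norm x)\<^sup>2 \<le> ip x x" for x
  proof (cases "x = 0")
    case False
    have "ip u u \<le> ip ((1 / norm x) *\<^sub>R x) ((1 / norm x) *\<^sub>R x)"
      using False by (intro u(2)) auto
    then show ?thesis using False by (simp add: ip_expand field_simps power2_eq_square)
  qed (simp add: ip_expand)
  moreover have "0 < ip u u" using u(1) by (intro ip_pos) auto
  ultimately show ?thesis by auto
next
  case False
  then show ?thesis using vector_choose_size[of 1, where 'a='a] by auto
qed

end

section \<open>Composite objectives and proximal steps\<close>

text \<open>
  With \<open>F\<close> for the sum: if no minimum were attained, the open sets \<open>{x. F y < F x}\<close> with \<open>y \<in> S\<close>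
  would cover \<open>S\<close>; but among the finitely many \<open>y\<close> that index a finite subcover, one with the
  smallest value \<open>F y\<close> is not covered.
\<close>

lemma continuous_plus_lsc_attains_min:
  fixes h :: "'a::euclidean_space \<Rightarrow> real" and \<phi> :: "'a \<Rightarrow> ereal"
  assumes "compact S" "S \<noteq> {}" "continuous_on UNIV h" "lsc \<phi>" "\<And>x. \<phi> x \<noteq> - \<infinity>"
  shows "\<exists>x\<in>S. \<forall>y\<in>S. ereal (h x) + \<phi> x \<le> ereal (h y) + \<phi> y"
proof (rule ccontr)
  define F where "F x = ereal (h x) + \<phi> x" for x
  assume "\<not> ?thesis"
  then have no_min: "\<exists>y\<in>S. F y < F x" if "x \<in> S" for x
    using that by (auto simp: F_def not_le)
  have opn: "open {x. F y < F x}" for y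
  proof (subst open_subopen, safe)
    fix x assume less: "F y < F x"
    have "\<phi> y \<noteq> \<infinity>" using less by (auto simp: F_def)
    then obtain c where c: "F y = ereal c"
      using assms(5)[of y] by (cases "\<phi> y") (auto simp: F_def)
    have "ereal (c - h x) < \<phi> x"
      using less c by (cases "\<phi> x") (auto simp: F_def)
    then obtain d where d: "c - h x < d" "ereal d < \<phi> x"
      using ereal_dense2 by force
    have "ereal d < Liminf (at x) \<phi>"
      using d(2) assms(4) unfolding lsc_def by (meson less_le_trans)
    then have "\<forall>\<^sub>F u in at x. ereal d < \<phi> u" by (rule less_LiminfD)
    then have "\<forall>\<^sub>F u in nhds x. ereal d < \<phi> u"
      using d(2) by (simp add: eventually_nhds_conv_at)
    moreover have "\<forall>\<^sub>F u in nhds x. c - d < h u"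
    proof -
      have "open {u. c - d < h u}"
        using assms(3) by (intro open_Collect_less continuous_on_const)
      then show ?thesis
        using d(1) eventually_nhds_in_open[of "{u. c - d < h u}" x] by auto
    qed
    ultimately have "\<forall>\<^sub>F u in nhds x. F y < F u"
    proof eventually_elim
      case (elim u)
      then show ?case unfolding c by (cases "\<phi> u") (auto simp: F_def)
    qed
    then show "\<exists>T. open T \<and> x \<in> T \<and> T \<subseteq> {x. F y < F x}"
      unfolding eventually_nhds by blast
  qed
  have "S \<subseteq> (\<Union>y\<in>S. {x. F y < F x})"
    using no_min by auto
  then obtain D where D: "D \<subseteq> S" "finite D" "S \<subseteq> (\<Union>y\<in>D. {x. F y < F x})"
    using opn assms(1) by (elim compactE_image) auto
  have "D \<noteq> {}" using D(3) assms(2) by auto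
  then have "Min (F ` D) \<in> F ` D" using D(2) by simp
  then obtain y where y: "y \<in> D" "F y = Min (F ` D)" by auto
  have "y \<in> (\<Union>y\<in>D. {x. F y < F x})" using y(1) D(1,3) by (meson subsetD)
  then obtain y' where "y' \<in> D" "F y' < F y" by auto
  then show False using y(2) D(2) by (metis Min_le finite_imageI imageI not_le)
qed

locale composite_problem = spd_form B
  for B :: "'a::euclidean_space \<Rightarrow> 'a \<Rightarrow>\<^sub>L real" +
  fixes f :: "'a \<Rightarrow> real" and f' :: "'a \<Rightarrow> 'a \<Rightarrow>\<^sub>L real" and \<Psi> :: "'a \<Rightarrow> ereal"
    and Lf \<mu>f \<mu>\<Psi> \<mu> :: real and xstar :: 'a
  assumes f_derivative: "\<And>z. (f has_derivative blinfun_apply (f' z)) (at z)"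
    and f'_Lipschitz: "\<And>z w. dual_norm B (f' z - f' w) \<le> Lf * primal_norm B (z - w)"
    and \<mu>f_nonneg: "0 \<le> \<mu>f"
    and f_convex: "convex_on UNIV (\<lambda>z. f z - \<mu>f / 2 * (primal_norm B z)\<^sup>2)"
    and \<Psi>_proper: "proper_ext \<Psi>" and \<Psi>_lsc: "lsc \<Psi>"
    and \<mu>\<Psi>_nonneg: "0 \<le> \<mu>\<Psi>"
    and \<Psi>_convex: "convex_ext (\<lambda>z. \<Psi> z - ereal (\<mu>\<Psi> / 2 * (primal_norm B z)\<^sup>2))"
    and \<mu>_eq: "\<mu> = \<mu>f + \<mu>\<Psi>"
    and xstar_min: "\<And>z. objective f \<Psi> xstar \<le> objective f \<Psi> z"
begin

lemma f'_Lipschitz_along: "\<bar>(f' z - f' w) (z - w)\<bar> \<le> Lf * ip (z - w) (z - w)"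
proof -
  have bound: "(f' z - f' w) u \<le> Lf * ip (z - w) (z - w)" if "ip u u = ip (z - w) (z - w)" for u
  proof -
    have norm_u: "primal_norm B u = primal_norm B (z - w)"
      using that by (simp add: primal_norm_def ip_def)
    have "(f' z - f' w) u \<le> dual_norm B (f' z - f' w) * primal_norm B (z - w)"
      using apply_le_norms[of "f' z - f' w" u] by (simp only: norm_u)
    also have "\<dots> \<le> Lf * primal_norm B (z - w) * primal_norm B (z - w)"
      using ip_nonneg
      by (intro mult_right_mono f'_Lipschitz) (simp add: primal_norm_def flip: ip_def)
    finally show ?thesis by (simp add: power2_eq_square flip: primal_norm_sq)
  qed
  have "(f' z - f' w) (- (z - w)) \<le> Lf * ip (z - w) (z - w)"
    by (rule bound) (simp only: ip_expand(5,6) minus_minus)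
  with bound[of "z - w"] show ?thesis by (simp only: blinfun.minus_right abs_le_iff)
qed

lemma quadratic_model_error:
  "\<bar>f x - f y - f' y (x - y)\<bar> \<le> Lf / 2 * ip (x - y) (x - y)"
proof -
  define d where "d = x - y"
  define e where "e t = f (y + t *\<^sub>R d) - f y - t * f' y d" for t :: real
  have "e 0 = 0" by (simp add: e_def)
  have f_line: "((\<lambda>t. f (y + t *\<^sub>R d)) has_real_derivative f' (y + t *\<^sub>R d) d) (at t)" for t
  proof -
    have "((\<lambda>t. f (y + t *\<^sub>R d)) has_derivative (\<lambda>s. f' (y + t *\<^sub>R d) (s *\<^sub>R d))) (at t)"
      by (rule has_derivative_compose[OF _ f_derivative]) (auto intro!: derivative_eq_intros)
    then show ?thesis
      by (simp add: has_field_derivative_def blinfun.scaleR_right mult.commute[of _ "f' _ _"])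
  qed
  have e_deriv: "(e has_real_derivative f' (y + t *\<^sub>R d) d - f' y d) (at t)" for t
    unfolding e_def by (auto intro!: derivative_eq_intros f_line)
  have e'_bound: "\<bar>f' (y + t *\<^sub>R d) d - f' y d\<bar> \<le> Lf * t * ip d d" if "0 \<le> t" for t
  proof (cases "t = 0")
    case False
    then have t: "0 < t" using that by simp
    have "(f' (y + t *\<^sub>R d) - f' y) (y + t *\<^sub>R d - y) = t * (f' (y + t *\<^sub>R d) d - f' y d)"
      by (simp add: blinfun.diff_left blinfun.scaleR_right right_diff_distrib)
    moreover have "ip (y + t *\<^sub>R d - y) (y + t *\<^sub>R d - y) = t * (t * ip d d)"
      by (simp add: ip_expand)
    ultimately have "t * \<bar>f' (y + t *\<^sub>R d) d - f' y d\<bar> \<le> t * (Lf * t * ip d d)"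
      using f'_Lipschitz_along[of "y + t *\<^sub>R d" y] t by (simp add: abs_mult mult_ac)
    then show ?thesis using t by simp
  qed simp
  have sq_deriv: "((\<lambda>t. Lf / 2 * t\<^sup>2 * ip d d) has_real_derivative Lf * t * ip d d) (at t)" for t
    by (auto intro!: derivative_eq_intros)
  have "e 1 - Lf / 2 * 1\<^sup>2 * ip d d \<le> e 0 - Lf / 2 * 0\<^sup>2 * ip d d"
  proof (rule DERIV_nonpos_imp_nonincreasing[where f = "\<lambda>t. e t - Lf / 2 * t\<^sup>2 * ip d d"])
    fix t :: real assume "0 \<le> t" "t \<le> 1"
    then show "\<exists>c. ((\<lambda>t. e t - Lf / 2 * t\<^sup>2 * ip d d) has_real_derivative c) (at t) \<and> c \<le> 0"
      using DERIV_diff[OF e_deriv sq_deriv, of t] e'_bound[of t] by (auto simp: abs_le_iff)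
  qed simp
  moreover have "e 0 + Lf / 2 * 0\<^sup>2 * ip d d \<le> e 1 + Lf / 2 * 1\<^sup>2 * ip d d"
  proof (rule DERIV_nonneg_imp_nondecreasing[where f = "\<lambda>t. e t + Lf / 2 * t\<^sup>2 * ip d d"])
    fix t :: real assume "0 \<le> t" "t \<le> 1"
    then show "\<exists>c. ((\<lambda>t. e t + Lf / 2 * t\<^sup>2 * ip d d) has_real_derivative c) (at t) \<and> 0 \<le> c"
      using DERIV_add[OF e_deriv sq_deriv, of t] e'_bound[of t] by (auto simp: abs_le_iff)
  qed simp
  ultimately have "\<bar>e 1\<bar> \<le> Lf / 2 * ip d d" 
    using \<open>e 0 = 0\<close> unfolding abs_le_iff by simp
  then show ?thesis by (simp only: e_def) (simp add: d_def)
qed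

lemma quadratic_model_error_along:
  "\<bar>f (y + t *\<^sub>R d) - f y - t * f' y d\<bar> \<le> t\<^sup>2 * (Lf / 2 * ip d d)"
  using quadratic_model_error[of "y + t *\<^sub>R d" y]
  by (simp add: ip_expand blinfun.scaleR_right power2_eq_square mult_ac)

lemma descent_test_passes:
  assumes "Lf \<le> l"
  shows "descent_test B f f' l y x"
proof -
  have "Lf / 2 * ip (x - y) (x - y) \<le> l / 2 * ip (x - y) (x - y)"
    using assms ip_nonneg by (intro mult_right_mono) auto
  then show ?thesis
    using quadratic_model_error[of x y] unfolding descent_test_def primal_norm_sq by linarith
qed

lemma f_strongly_convex_segment:
  assumes "0 \<le> t" "t \<le> 1"
  shows "f (y + t *\<^sub>R (z - y))
    \<le> (1 - t) * f y + t * f z - \<mu>f / 2 * t * (1 - t) * ip (z - y) (z - y)"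
proof -
  let ?u = "y + t *\<^sub>R (z - y)"
  have u: "(1 - t) *\<^sub>R y + t *\<^sub>R z = ?u" by (simp add: algebra_simps)
  have "f ?u - \<mu>f / 2 * ip ?u ?u \<le> (1 - t) * (f y - \<mu>f / 2 * ip y y) + t * (f z - \<mu>f / 2 * ip z z)"
    using convex_onD[OF f_convex assms, of y z] by (simp only: primal_norm_sq u UNIV_I)
  then show ?thesis
    unfolding ip_convex_combination by (simp only: algebra_simps)
qed

lemma f_strongly_convex:
  "f y + f' y (z - y) + \<mu>f / 2 * ip (z - y) (z - y) \<le> f z"
proof -
  define d where "d = z - y"
  have "0 \<le> f z - f y - f' y d - \<mu>f / 2 * ip d d"
  proof (rule linear_term_nonneg)
    fix t :: real assume t: "0 < t" "t \<le> 1"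
    have "f y + t * f' y d - t\<^sup>2 * (Lf / 2 * ip d d) \<le> f (y + t *\<^sub>R d)"
      using quadratic_model_error_along[of y t d] by linarith
    then show "0 \<le> t * (f z - f y - f' y d - \<mu>f / 2 * ip d d)
        + t\<^sup>2 * (Lf / 2 * ip d d + \<mu>f / 2 * ip d d)"
      using f_strongly_convex_segment[of t y z] t
      by (simp add: algebra_simps power2_eq_square add_divide_distrib diff_divide_distrib flip: d_def)
  qed
  then show ?thesis by (simp add: d_def)
qed

lemma \<Psi>_not_MInf: "\<Psi> z \<noteq> - \<infinity>"
  using \<Psi>_proper by (simp add: proper_ext_def)

lemma \<Psi>_strongly_convex_segment:
  assumes "\<Psi> x = ereal px" "\<Psi> w = ereal pw" "0 \<le> t" "t \<le> 1"
  shows "\<Psi> (x + t *\<^sub>R (w - x))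
    \<le> ereal ((1 - t) * px + t * pw - \<mu>\<Psi> / 2 * t * (1 - t) * ip (w - x) (w - x))"
proof -
  define u where "u = (1 - t) *\<^sub>R x + t *\<^sub>R w"
  have u: "x + t *\<^sub>R (w - x) = u" by (simp add: u_def algebra_simps)
  have "\<Psi> u - ereal (\<mu>\<Psi> / 2 * ip u u)
      \<le> ereal ((1 - t) * (px - \<mu>\<Psi> / 2 * ip x x) + t * (pw - \<mu>\<Psi> / 2 * ip w w))"
    using \<Psi>_convex[unfolded convex_ext_def, rule_format, of t x w] assms
    by (simp add: primal_norm_sq flip: u_def)
  then have "\<Psi> u \<le> ereal ((1 - t) * (px - \<mu>\<Psi> / 2 * ip x x) + t * (pw - \<mu>\<Psi> / 2 * ip w w)
      + \<mu>\<Psi> / 2 * ip u u)"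
    by (cases "\<Psi> u") auto
  also have "(1 - t) * (px - \<mu>\<Psi> / 2 * ip x x) + t * (pw - \<mu>\<Psi> / 2 * ip w w) + \<mu>\<Psi> / 2 * ip u u
      = (1 - t) * px + t * pw - \<mu>\<Psi> / 2 * t * (1 - t) * ip (w - x) (w - x)"
    unfolding u[symmetric] ip_convex_combination by (simp add: algebra_simps add_divide_distrib diff_divide_distrib)
  finally show ?thesis by (simp add: u)
qed

text \<open>
  Here \<open>h\<close> is any smooth part for which \<open>x\<close> minimizes \<open>h + \<Psi>\<close>: a subgradient inequality for \<open>\<Psi>\<close>
  with the strong convexity term. It is used with \<open>h = f\<close> at the minimizer of the objective and
  with the quadratic model at a proximal point. A quadratic bound on \<open>h\<close> along the segment suffices,
  so that derivatives of \<open>h\<close> do not appear.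
\<close>

lemma first_order_optimality:
  fixes h :: "'a \<Rightarrow> real"
  assumes px: "\<Psi> x = ereal px" and pw: "\<Psi> w = ereal pw"
    and opt: "\<And>u. ereal (h x) + \<Psi> x \<le> ereal (h u) + \<Psi> u"
    and expansion: "\<And>t. 0 < t \<Longrightarrow> t \<le> 1 \<Longrightarrow> h (x + t *\<^sub>R (w - x)) \<le> h x + t * l + t\<^sup>2 * c"
  shows "px - l + \<mu>\<Psi> / 2 * ip (w - x) (w - x) \<le> pw"
proof -
  define D where "D = ip (w - x) (w - x)"
  have "0 \<le> pw - px + l - \<mu>\<Psi> / 2 * D"
  proof (rule linear_term_nonneg)
    fix t :: real assume t: "0 < t" "t \<le> 1"
    let ?u = "x + t *\<^sub>R (w - x)"
    have "ereal (h x) + ereal px \<le> ereal (h ?u) + \<Psi> ?u" using opt[of ?u] px by simp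
    also have "\<dots> \<le> ereal (h ?u) + ereal ((1 - t) * px + t * pw - \<mu>\<Psi> / 2 * t * (1 - t) * D)"
      unfolding D_def using px pw t by (intro add_left_mono \<Psi>_strongly_convex_segment) auto
    finally have "h x + px \<le> h ?u + ((1 - t) * px + t * pw - \<mu>\<Psi> / 2 * t * (1 - t) * D)" by simp
    then have "h x + px \<le> h x + t * l + t\<^sup>2 * c
        + ((1 - t) * px + t * pw - \<mu>\<Psi> / 2 * t * (1 - t) * D)"
      using expansion[OF t] by linarith
    then show "0 \<le> t * (pw - px + l - \<mu>\<Psi> / 2 * D) + t\<^sup>2 * (c + \<mu>\<Psi> / 2 * D)"
      by (simp add: algebra_simps power2_eq_square add_divide_distrib diff_divide_distrib)
  qed
  then show ?thesis by (simp add: D_def)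
qed

lemma \<Psi>_xstar_finite: "\<exists>p. \<Psi> xstar = ereal p"
proof -
  obtain z where "\<Psi> z \<noteq> \<infinity>" using \<Psi>_proper by (auto simp: proper_ext_def)
  then have "\<Psi> xstar \<noteq> \<infinity>"
    using xstar_min[of z] by (auto simp: objective_def)
  then show ?thesis using \<Psi>_not_MInf[of xstar] by (cases "\<Psi> xstar") auto
qed

lemma objective_growth:
  assumes "objective f \<Psi> xstar = ereal Fs" "objective f \<Psi> z = ereal Fz"
  shows "Fs + \<mu> / 2 * ip (z - xstar) (z - xstar) \<le> Fz"
proof -
  obtain ps pz where p: "\<Psi> xstar = ereal ps" "\<Psi> z = ereal pz"
    using assms by (cases "\<Psi> xstar"; cases "\<Psi> z") (auto simp: objective_def)
  have "ps - (f z - f xstar - \<mu>f / 2 * ip (z - xstar) (z - xstar)) + \<mu>\<Psi> / 2 * ip (z - xstar) (z - xstar) \<le> pz"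
  proof (rule first_order_optimality[OF p, where h = f])
    show "ereal (f xstar) + \<Psi> xstar \<le> ereal (f u) + \<Psi> u" for u
      using xstar_min[of u] by (simp add: objective_def)
    fix t :: real assume "0 < t" "t \<le> 1"
    then show "f (xstar + t *\<^sub>R (z - xstar)) \<le> f xstar
        + t * (f z - f xstar - \<mu>f / 2 * ip (z - xstar) (z - xstar))
        + t\<^sup>2 * (\<mu>f / 2 * ip (z - xstar) (z - xstar))"
      using f_strongly_convex_segment[of t xstar z]
      by (simp add: algebra_simps power2_eq_square add_divide_distrib diff_divide_distrib)
  qed
  then show ?thesis using assms p by (auto simp: objective_def \<mu>_eq algebra_simps add_divide_distrib)
qed

text \<open>
  Optimality of \<open>xstar\<close> says that \<open>- f' xstar\<close> is a subgradient of \<open>\<Psi>\<close>. Thus the existence of a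
  minimizer of the objective supplies the affine minorant that makes the proximal model coercive,
  without a separation theorem.
\<close>

lemma \<Psi>_affine_minorant:
  assumes "\<Psi> xstar = ereal ps"
  shows "ereal (ps - f' xstar (w - xstar)) \<le> \<Psi> w"
proof (cases "\<Psi> w")
  case (real pw)
  have "ps - f' xstar (w - xstar) + \<mu>\<Psi> / 2 * ip (w - xstar) (w - xstar) \<le> pw"
  proof (rule first_order_optimality[OF assms real, where h = f])
    show "ereal (f xstar) + \<Psi> xstar \<le> ereal (f u) + \<Psi> u" for u
      using xstar_min[of u] by (simp add: objective_def)
    fix t :: real assume "0 < t" "t \<le> 1"
    then show "f (xstar + t *\<^sub>R (w - xstar)) \<le> f xstar + t * f' xstar (w - xstar)
        + t\<^sup>2 * (Lf / 2 * ip (w - xstar) (w - xstar))"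
      using quadratic_model_error_along[of xstar t "w - xstar"] by linarith
  qed
  moreover have "0 \<le> \<mu>\<Psi> / 2 * ip (w - xstar) (w - xstar)"
    using \<mu>\<Psi>_nonneg ip_nonneg by simp
  ultimately show ?thesis by (simp add: real)
qed (use \<Psi>_not_MInf[of w] in auto)

text \<open>
  The affine minorant of \<open>\<Psi>\<close> bounds the model from below by its value at \<open>xstar\<close> plus a linear form
  \<open>l\<close> and a positive definite quadratic; outside a ball around \<open>xstar\<close> the model therefore exceeds its
  value at \<open>xstar\<close>, and inside the ball lower semicontinuity applies.
\<close>

lemma prox_model_has_minimizer:
  assumes "0 < L"
  shows "\<exists>x. \<forall>w. prox_model B f f' \<Psi> L z x \<le> prox_model B f f' \<Psi> L z w"
proof -
  obtain ps where ps: "\<Psi> xstar = ereal ps" using \<Psi>_xstar_finite by blast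
  define h where "h w = f z + f' z (w - z) + L / 2 * ip (w - z) (w - z)" for w
  have model: "prox_model B f f' \<Psi> L z w = ereal (h w) + \<Psi> w" for w
    by (simp add: prox_model_def h_def primal_norm_sq)
  define l where "l = f' z - f' xstar + L *\<^sub>R B (xstar - z)"
  have l: "l d = f' z d - f' xstar d + L * ip (xstar - z) d" for d
    by (simp add: l_def blinfun.bilinear_simps ip_def)
  have below: "ereal (h xstar + ps + l d + L / 2 * ip d d) \<le> ereal (h (xstar + d)) + \<Psi> (xstar + d)" for d
  proof -
    have "h xstar + ps + l d + L / 2 * ip d d = h (xstar + d) + (ps - f' xstar d)"
      by (simp add: h_def l blinfun.bilinear_simps ip_expand ip_commute algebra_simps add_divide_distrib diff_divide_distrib)
    moreover have "ereal (ps - f' xstar d) \<le> \<Psi> (xstar + d)"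
      using \<Psi>_affine_minorant[OF ps, of "xstar + d"] by simp
    ultimately show ?thesis by (cases "\<Psi> (xstar + d)") (auto simp del: add_diff_eq)
  qed
  obtain m where m: "0 < m" "\<And>x. m * (norm x)\<^sup>2 \<le> ip x x" using ip_coercive by blast
  define R where "R = 2 * norm l / (L * m)"
  have R: "0 \<le> R" using assms m(1) by (simp add: R_def)
  have far: "ereal (h xstar) + \<Psi> xstar \<le> ereal (h w) + \<Psi> w" if "R < norm (w - xstar)" for w
  proof -
    let ?d = "w - xstar"
    have "2 * norm l < L * m * norm ?d"
      using that assms m(1) by (simp add: R_def field_simps)
    then have "2 * norm l * norm ?d \<le> L * m * norm ?d * norm ?d"
      by (intro mult_right_mono) auto
    moreover have "\<bar>l ?d\<bar> \<le> norm l * norm ?d"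
      using norm_blinfun[of l ?d] by simp
    moreover have "L * (m * (norm ?d)\<^sup>2) \<le> L * ip ?d ?d"
      using m(2) assms by (intro mult_left_mono) auto
    ultimately have "0 \<le> l ?d + L / 2 * ip ?d ?d"
      by (auto simp: power2_eq_square abs_le_iff algebra_simps)
    then have "ereal (h xstar + ps) \<le> ereal (h xstar + ps + l ?d + L / 2 * ip ?d ?d)" by simp
    also have "\<dots> \<le> ereal (h w) + \<Psi> w" using below[of ?d] by simp
    finally show ?thesis by (simp add: ps)
  qed
  have "continuous_on UNIV h"
    unfolding h_def by (intro continuous_intros continuous_ip_diag)
  moreover have "cball xstar R \<noteq> {}" using R by simp
  ultimately have "\<exists>x\<in>cball xstar R. \<forall>w\<in>cball xstar R. ereal (h x) + \<Psi> x \<le> ereal (h w) + \<Psi> w"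
    by (intro continuous_plus_lsc_attains_min compact_cball \<Psi>_lsc \<Psi>_not_MInf)
  then obtain x where x: "\<And>w. w \<in> cball xstar R \<Longrightarrow> ereal (h x) + \<Psi> x \<le> ereal (h w) + \<Psi> w"
    by blast
  have "ereal (h x) + \<Psi> x \<le> ereal (h w) + \<Psi> w" for w
  proof (cases "w \<in> cball xstar R")
    case False
    then have "ereal (h xstar) + \<Psi> xstar \<le> ereal (h w) + \<Psi> w"
      by (intro far) (simp add: dist_norm norm_minus_commute)
    moreover have "ereal (h x) + \<Psi> x \<le> ereal (h xstar) + \<Psi> xstar" using R by (intro x) simp
    ultimately show ?thesis by (rule order_trans[rotated])
  qed (rule x)
  then show ?thesis unfolding model by blast
qed

lemma prox_grad_minimizes:
  assumes "0 < L"
  shows "prox_model B f f' \<Psi> L z (prox_grad B f f' \<Psi> L z) \<le> prox_model B f f' \<Psi> L z w"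
proof -
  have "\<exists>x. is_arg_min (prox_model B f f' \<Psi> L z) (\<lambda>x. True) x"
    using prox_model_has_minimizer[OF assms, of z] by (auto simp: is_arg_min_linorder)
  then have "is_arg_min (prox_model B f f' \<Psi> L z) (\<lambda>x. True) (prox_grad B f f' \<Psi> L z)"
    unfolding prox_grad_def arg_min_def by (rule someI_ex)
  then show ?thesis by (simp add: is_arg_min_linorder)
qed

lemma \<Psi>_prox_grad_finite:
  assumes "0 < L"
  shows "\<exists>p. \<Psi> (prox_grad B f f' \<Psi> L z) = ereal p"
proof -
  obtain ps where "\<Psi> xstar = ereal ps" using \<Psi>_xstar_finite by blast
  then have "\<Psi> (prox_grad B f f' \<Psi> L z) \<noteq> \<infinity>"
    using prox_grad_minimizes[OF assms, of z xstar] by (auto simp: prox_model_def)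
  then show ?thesis using \<Psi>_not_MInf by (cases "\<Psi> (prox_grad B f f' \<Psi> L z)") auto
qed

text \<open>
  The lower model of the objective produced by one proximal step. It adds strong convexity of \<open>f\<close>
  at \<open>y\<close>, the optimality condition of \<open>x\<close> for \<open>\<Psi>\<close>, and the descent test, which exchanges \<open>f y\<close> for
  \<open>f x\<close>.
\<close>

lemma objective_lower_bound:
  assumes L: "0 < L" and x: "x = prox_grad B f f' \<Psi> L y"
    and descent: "descent_test B f f' L y x"
    and Fx: "objective f \<Psi> x = ereal Fx" and Fw: "objective f \<Psi> w = ereal Fw"
  shows "Fx + (L + \<mu>\<Psi>) / 2 * ip (y - x) (y - x) + (L + \<mu>\<Psi>) * ip (y - x) (w - y)
      + \<mu> / 2 * ip (w - y) (w - y) \<le> Fw"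
proof -
  obtain px pw where p: "\<Psi> x = ereal px" "\<Psi> w = ereal pw"
    using Fx Fw by (cases "\<Psi> x"; cases "\<Psi> w") (auto simp: objective_def)
  define h where "h u = f y + f' y (u - y) + L / 2 * ip (u - y) (u - y)" for u
  have "px - (f' y (w - x) + L * ip (x - y) (w - x)) + \<mu>\<Psi> / 2 * ip (w - x) (w - x) \<le> pw"
  proof (rule first_order_optimality[OF p, where h = h])
    show "ereal (h x) + \<Psi> x \<le> ereal (h u) + \<Psi> u" for u
      using prox_grad_minimizes[OF L, of y u] by (simp add: x h_def prox_model_def primal_norm_sq)
    fix t :: real
    show "h (x + t *\<^sub>R (w - x)) \<le> h x + t * (f' y (w - x) + L * ip (x - y) (w - x))
        + t\<^sup>2 * (L / 2 * ip (w - x) (w - x))"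
      by (simp add: h_def blinfun.bilinear_simps ip_expand ip_commute power2_eq_square algebra_simps)
  qed
  moreover have "f x \<le> f y + f' y (x - y) + L / 2 * ip (x - y) (x - y)"
    using descent by (simp add: descent_test_def primal_norm_sq)
  moreover have "f y + f' y (w - y) + \<mu>f / 2 * ip (w - y) (w - y) \<le> f w"
    by (rule f_strongly_convex)
  moreover have "f' y (w - y) = f' y (w - x) + f' y (x - y)"
    by (simp add: blinfun.bilinear_simps)
  moreover have "(L + \<mu>\<Psi>) / 2 * ip (y - x) (y - x) + (L + \<mu>\<Psi>) * ip (y - x) (w - y)
      + \<mu> / 2 * ip (w - y) (w - y)
    = - (L * ip (x - y) (w - x)) - L / 2 * ip (x - y) (x - y) + \<mu>\<Psi> / 2 * ip (w - x) (w - x)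
      + \<mu>f / 2 * ip (w - y) (w - y)"
    by (simp add: \<mu>_eq ip_expand ip_commute algebra_simps add_divide_distrib)
  ultimately show ?thesis using Fx Fw p by (auto simp: objective_def)
qed

end

section \<open>The weight recursion\<close>

text \<open>
  One step of the scalar recursion with constant dampening parameter; primes mark the index \<open>k + 1\<close>,
  \<open>M\<close> stands for \<open>L (k + 1) + \<mu>\<Psi>\<close>, and the closed form of \<open>\<gamma>\<close> is the invariant of the recursion.
\<close>

locale weight_step =
  fixes \<mu> M q \<alpha> A a A' abar \<gamma> \<gamma>' \<gamma>bar :: real
  assumes \<mu>_pos: "0 < \<mu>" and \<mu>_less: "\<mu> < M" and q_eq: "q = \<mu> / M"
    and \<alpha>: "0 \<le> \<alpha>" "\<alpha> \<le> 1"
    and A_nonneg: "0 \<le> A"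
    and \<gamma>_eq: "\<gamma> = 1 + \<mu> * (1 + \<alpha>) * A"
    and a_eq: "a = 1 / (2 * (M - \<mu>)) * (\<gamma> + \<mu> * (1 - \<alpha>) * A
        + sqrt ((\<gamma> + \<mu> * (1 - \<alpha>) * A)\<^sup>2
            + 4 * (M - \<mu>) * A * (\<gamma> + \<mu> * (\<alpha> / (1 + q * \<alpha>) - \<alpha>) * A)))"
    and A'_eq: "A' = A + a"
    and abar_eq: "abar = a + q * \<alpha> * A'"
    and \<gamma>'_eq: "\<gamma>' = \<gamma> + \<mu> * (a + \<alpha> * A' - \<alpha> * A)"
    and \<gamma>bar_eq: "\<gamma>bar = \<gamma>' - \<mu> * \<alpha> * abar"
begin

lemma M_pos: "0 < M" using \<mu>_pos \<mu>_less by simp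

lemma q_pos: "0 < q" using \<mu>_pos M_pos by (simp add: q_eq)

lemma q_less_1: "q < 1" using \<mu>_less M_pos by (simp add: q_eq)

lemma \<mu>_M: "\<mu> = q * M" using M_pos by (simp add: q_eq)

lemma q\<alpha>_pos: "0 < 1 + q * \<alpha>" using q_pos \<alpha> by (simp add: add_pos_nonneg)

lemma \<gamma>_ge_1: "1 \<le> \<gamma>"
  using \<mu>_pos \<alpha> A_nonneg by (simp add: \<gamma>_eq)

lemma discriminant_term_nonneg: "0 \<le> \<gamma> + \<mu> * (\<alpha> / (1 + q * \<alpha>) - \<alpha>) * A"
proof -
  have "\<gamma> + \<mu> * (\<alpha> / (1 + q * \<alpha>) - \<alpha>) * A = 1 + \<mu> * A * (1 + \<alpha> / (1 + q * \<alpha>))"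
    by (simp add: \<gamma>_eq algebra_simps)
  then show ?thesis
    using \<mu>_pos \<alpha> A_nonneg q\<alpha>_pos by simp
qed

lemma a_lower: "1 / (M - \<mu>) \<le> a"
proof -
  define p where "p = \<gamma> + \<mu> * (1 - \<alpha>) * A"
  have "1 \<le> p" using \<gamma>_ge_1 \<mu>_pos \<alpha> A_nonneg by (simp add: p_def add_increasing2)
  moreover have "sqrt (p\<^sup>2) \<le> sqrt (p\<^sup>2
            + 4 * (M - \<mu>) * A * (\<gamma> + \<mu> * (\<alpha> / (1 + q * \<alpha>) - \<alpha>) * A))"
    using discriminant_term_nonneg A_nonneg \<mu>_less by (intro real_sqrt_le_mono) simp
  ultimately have "2 \<le> p + sqrt (p\<^sup>2
            + 4 * (M - \<mu>) * A * (\<gamma> + \<mu> * (\<alpha> / (1 + q * \<alpha>) - \<alpha>) * A))" by simp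
  then have "1 / (2 * (M - \<mu>)) * 2 \<le> a"
    unfolding a_eq p_def[symmetric] using \<mu>_less by (intro mult_left_mono) auto
  also have "1 / (2 * (M - \<mu>)) * 2 = 1 / (M - \<mu>)"
  proof -
    have "1 / (2 * d) * 2 = 1 / d" for d :: real by simp
    then show ?thesis .
  qed
  finally show ?thesis .
qed

lemma a_pos: "0 < a"
  using less_le_trans[OF _ a_lower, of 0] \<mu>_less by simp

lemma A'_pos: "0 < A'"
  using a_pos A_nonneg by (simp add: A'_eq)

text \<open>The quadratic equation whose positive root the method computes, freed of \<open>\<gamma>\<close>.\<close>

lemma a_square: "M * a\<^sup>2 = A' + \<mu> * A'\<^sup>2 + \<mu> * \<alpha> * A\<^sup>2 / (1 + q * \<alpha>)"
proof -
  define p where "p = \<gamma> + \<mu> * (1 - \<alpha>) * A"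
  define c where "c = A * (\<gamma> + \<mu> * (\<alpha> / (1 + q * \<alpha>) - \<alpha>) * A)"
  define s where "s = sqrt (p\<^sup>2 + 4 * (M - \<mu>) * c)"
  have "0 \<le> c" using discriminant_term_nonneg A_nonneg by (simp add: c_def)
  then have s: "s\<^sup>2 = p\<^sup>2 + 4 * (M - \<mu>) * c"
    using \<mu>_less by (simp add: s_def)
  have "2 * (M - \<mu>) * a = p + s"
    using \<mu>_less by (simp add: a_eq p_def c_def s_def mult_ac)
  then have "(2 * (M - \<mu>) * a - p)\<^sup>2 = p\<^sup>2 + 4 * (M - \<mu>) * c"
    using s by simp
  then have "4 * (M - \<mu>) * ((M - \<mu>) * a\<^sup>2 - p * a - c) = 0"
    by (simp add: algebra_simps power2_eq_square)
  then have "(M - \<mu>) * a\<^sup>2 = p * a + c" using \<mu>_less by simp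
  moreover have "p = 1 + 2 * \<mu> * A" by (simp add: p_def \<gamma>_eq algebra_simps)
  moreover have "c = A * (1 + \<mu> * A) + \<mu> * \<alpha> * A\<^sup>2 / (1 + q * \<alpha>)"
    by (simp add: c_def \<gamma>_eq algebra_simps power2_eq_square)
  ultimately show ?thesis
    by (simp add: A'_eq algebra_simps power2_eq_square)
qed

lemma \<gamma>'_canonical: "\<gamma>' = 1 + \<mu> * (1 + \<alpha>) * A'"
  by (simp add: \<gamma>'_eq \<gamma>_eq A'_eq algebra_simps)

lemma abar_pos: "0 < abar"
  using a_pos q_pos \<alpha> A'_pos by (simp add: abar_eq add_pos_nonneg)

lemma \<gamma>bar_ge_1: "1 \<le> \<gamma>bar"
proof -
  have "a + q * \<alpha> * A' \<le> A' + 1 * \<alpha> * A'"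
    using q_less_1 \<alpha> A'_pos A_nonneg by (intro add_mono mult_right_mono) (simp_all add: A'_eq)
  also have "\<dots> = (1 + \<alpha>) * A'" by (simp add: algebra_simps)
  finally have "\<mu> * (\<alpha> * abar) \<le> \<mu> * (1 * ((1 + \<alpha>) * A'))"
    using \<mu>_pos \<alpha> abar_pos by (intro mult_left_mono mult_mono) (auto simp: abar_eq)
  then show ?thesis by (simp add: \<gamma>bar_eq \<gamma>'_canonical mult_ac)
qed

lemma \<gamma>'_ge_1: "1 \<le> \<gamma>'"
  using \<mu>_pos \<alpha> A'_pos by (simp add: \<gamma>'_canonical)

lemma \<gamma>_sum: "\<gamma> + \<mu> * (1 + \<alpha>) * a = \<gamma>'"
  by (simp add: \<gamma>'_eq A'_eq algebra_simps)

text \<open>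
  Writing \<open>A = A' - a\<close> makes the equation homogeneous in \<open>a\<close> and \<open>A'\<close> up to the term linear in \<open>A'\<close>;
  both consequences below are read off from this form.
\<close>

lemma a_square_cleared:
  "M * a\<^sup>2 + 2 * \<mu> * \<alpha> * a * A' = (1 + q * \<alpha>) * A' + \<mu> * (1 + \<alpha> + q * \<alpha>) * A'\<^sup>2"
proof -
  have "(1 + q * \<alpha>) * (M * a\<^sup>2) = (1 + q * \<alpha>) * (A' + \<mu> * A'\<^sup>2) + \<mu> * \<alpha> * A\<^sup>2"
    using q\<alpha>_pos by (simp add: a_square distrib_left[of "1 + q * \<alpha>"])
  moreover have "A = A' - a" by (simp add: A'_eq)
  ultimately show ?thesis by (simp add: \<mu>_M algebra_simps power2_eq_square)
qed

text \<open>
  The reason for the choice of \<open>a\<close>: with this equality the squared norm of the gradient drops out of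
  the minimum of the estimate function.
\<close>

lemma abar_square: "M * abar\<^sup>2 = A' * (1 + q * \<alpha>) * \<gamma>'"
proof -
  have "M * abar\<^sup>2 = (M * a\<^sup>2 + 2 * \<mu> * \<alpha> * a * A') + \<mu> * q * \<alpha>\<^sup>2 * A'\<^sup>2"
    by (simp add: abar_eq \<mu>_M algebra_simps power2_eq_square)
  also have "\<dots> = A' * (1 + q * \<alpha>) * \<gamma>'"
    unfolding a_square_cleared \<gamma>'_canonical by (simp add: algebra_simps power2_eq_square)
  finally show ?thesis .
qed

lemma ratio_quadratic:
  "q * (1 + \<alpha> + q * \<alpha>) \<le> (a / A')\<^sup>2 + 2 * q * \<alpha> * (a / A')"
proof -
  have "0 < (1 + q * \<alpha>) * A'" using q\<alpha>_pos A'_pos by simp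
  then have "0 \<le> M * (a\<^sup>2 + 2 * q * \<alpha> * a * A' - q * (1 + \<alpha> + q * \<alpha>) * A'\<^sup>2)"
    using a_square_cleared by (simp add: \<mu>_M algebra_simps power2_eq_square)
  then have "q * (1 + \<alpha> + q * \<alpha>) * A'\<^sup>2 \<le> a\<^sup>2 + 2 * q * \<alpha> * a * A'"
    using M_pos by (simp add: zero_le_mult_iff)
  then have "q * (1 + \<alpha> + q * \<alpha>) * A'\<^sup>2 / A'\<^sup>2 \<le> (a\<^sup>2 + 2 * q * \<alpha> * a * A') / A'\<^sup>2"
    by (intro divide_right_mono) auto
  also have "\<dots> = (a / A')\<^sup>2 + 2 * q * \<alpha> * (a / A')"
    using A'_pos by (simp add: add_divide_distrib power2_eq_square)
  finally show ?thesis using A'_pos by simp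
qed

end

section \<open>Growth rate and dampening parameters\<close>

text \<open>This number is the positive root of \<open>t\<^sup>2 + 2 q \<alpha> t = q (1 + \<alpha> + q \<alpha>)\<close> in \<open>t\<close>.\<close>

lemma rate_times_sqrt:
  assumes "0 \<le> q"
  shows "rate q \<alpha> * sqrt q = sqrt (q * (1 + \<alpha>) * (1 + q * \<alpha>)) - q * \<alpha>"
  using assms by (simp add: rate_def algebra_simps flip: real_sqrt_mult)

text \<open>
  The inequality satisfied by \<open>t\<close> for \<open>q'\<close> is inherited by every smaller \<open>q\<close>, because \<open>t \<le> 1\<close>;
  this is how a bound on all the Lipschitz estimates enters the rate.
\<close>

lemma rate_times_sqrt_le:
  assumes "0 \<le> q" "q \<le> q'" "0 \<le> \<alpha>" "\<alpha> \<le> 1" "0 \<le> t" "t \<le> 1"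
    and quad: "q' * (1 + \<alpha> + q' * \<alpha>) \<le> t\<^sup>2 + 2 * q' * \<alpha> * t"
  shows "rate q \<alpha> * sqrt q \<le> t"
proof -
  have "q * (1 + \<alpha> + q * \<alpha>) \<le> t\<^sup>2 + 2 * q * \<alpha> * t"
  proof -
    have "\<alpha> * t \<le> \<alpha>" using assms(3,6) by (simp add: mult_left_le)
    moreover have "0 \<le> (q + q') * \<alpha>" using assms(1-3) by simp
    ultimately have "2 * \<alpha> * t \<le> 1 + \<alpha> + (q + q') * \<alpha>"
      using assms(4) by linarith
    then have "(q' - q) * (2 * \<alpha> * t) \<le> (q' - q) * (1 + \<alpha> + (q + q') * \<alpha>)"
      using assms by (intro mult_left_mono) auto
    then show ?thesis using quad by (simp add: algebra_simps)
  qed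
  then have "q * (1 + \<alpha>) * (1 + q * \<alpha>) \<le> (t + q * \<alpha>)\<^sup>2"
    by (simp add: algebra_simps power2_eq_square)
  then have "sqrt (q * (1 + \<alpha>) * (1 + q * \<alpha>)) \<le> t + q * \<alpha>"
    using assms by (intro real_le_lsqrt) auto
  then show ?thesis using assms by (simp add: rate_times_sqrt)
qed

text \<open>
  A sufficient condition for the increment of the estimate sequence to be nonnegative. It is weaker
  than \<open>delta_fun q \<alpha> \<ge> 0\<close>: the difference of the two expressions is
  \<open>sqrt q * (1 - \<alpha>\<^sup>2) * (1 + q * \<alpha>)\<close>, the contribution of the weight \<open>\<gamma>\<close>. This surplus is what makes
  the constant parameter 0.7542 work for every \<open>q\<close> and what absorbs the variation of \<open>q\<close> from step
  to step.
\<close>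

definition progress_margin :: "real \<Rightarrow> real \<Rightarrow> real" where
  "progress_margin q \<alpha> = (1 - \<alpha>) * sqrt ((1 + \<alpha>) * (1 + q * \<alpha>)) + sqrt q * (1 - \<alpha> - \<alpha>\<^sup>2 + q * \<alpha>)"

text \<open>
  The bracket is, up to the factor one half, the coefficient of the squared norm of \<open>x k - y (k + 1)\<close>
  that is left after completing the square in the next estimate function. Multiplied by
  \<open>abar\<^sup>2 * \<gamma>\<close>, it turns with \<open>abar_square\<close> into an expression linear in the ratio \<open>t = a / A'\<close>. Two
  estimates finish: \<open>\<gamma> \<ge> \<mu> * (1 + \<alpha>) * A\<close> and \<open>t \<ge> rate q \<alpha> * sqrt q\<close>.
\<close>

lemma (in weight_step) residual_weight_nonneg:
  assumes "0 \<le> progress_margin q \<alpha>"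
  shows "0 \<le> A * (\<mu> * (1 - \<alpha>) + A * \<gamma>bar\<^sup>2 / (abar\<^sup>2 * \<gamma>) - A * \<gamma>' / abar\<^sup>2)"
proof -
  define u where "u = 1 + q * \<alpha>"
  define t where "t = a / A'"
  have u: "0 < u" using q\<alpha>_pos by (simp add: u_def)
  have t: "0 < t" "t \<le> 1" "a = t * A'"
    using a_pos A'_pos A_nonneg by (simp_all add: t_def A'_eq)
  have "rate q \<alpha> * sqrt q \<le> t"
    using ratio_quadratic q_pos \<alpha> t(1,2)
    by (intro rate_times_sqrt_le[of q q]) (auto simp flip: t_def)
  then have rate: "rate q \<alpha> * sqrt q * sqrt q \<le> t * sqrt q" using q_pos by (intro mult_right_mono) auto
  have "0 \<le> (1 - \<alpha>\<^sup>2) * u - \<alpha>\<^sup>2 * (1 - q * \<alpha>) + (1 - \<alpha>) * t / q"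
  proof -
    let ?s = "sqrt q"
    have s: "0 < ?s" "?s * ?s = q" using q_pos by auto
    have "q * rate q \<alpha> \<le> t * ?s" using rate s(2) by (metis mult.assoc mult.commute)
    then have "(1 - \<alpha>) * (q * rate q \<alpha>) \<le> (1 - \<alpha>) * (t * ?s)" using \<alpha> by (intro mult_left_mono) auto
    then have "q * (?s * ((1 - \<alpha>\<^sup>2) * u - \<alpha>\<^sup>2 * (1 - q * \<alpha>)) + (1 - \<alpha>) * rate q \<alpha>)
      \<le> ?s * (q * ((1 - \<alpha>\<^sup>2) * u - \<alpha>\<^sup>2 * (1 - q * \<alpha>)) + (1 - \<alpha>) * t)"
      by (simp add: algebra_simps)
    moreover have "?s * ((1 - \<alpha>\<^sup>2) * u - \<alpha>\<^sup>2 * (1 - q * \<alpha>)) + (1 - \<alpha>) * rate q \<alpha> = progress_margin q \<alpha>"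
      by (simp add: progress_margin_def rate_def u_def algebra_simps power2_eq_square)
    ultimately have "q * progress_margin q \<alpha>
        \<le> ?s * (q * ((1 - \<alpha>\<^sup>2) * u - \<alpha>\<^sup>2 * (1 - q * \<alpha>)) + (1 - \<alpha>) * t)"
      by (simp only:)
    moreover have "0 \<le> q * progress_margin q \<alpha>" using assms q_pos by simp
    ultimately have "0 \<le> ?s * (q * ((1 - \<alpha>\<^sup>2) * u - \<alpha>\<^sup>2 * (1 - q * \<alpha>)) + (1 - \<alpha>) * t)"
      by (rule order_trans[rotated])
    then have "0 \<le> (q * ((1 - \<alpha>\<^sup>2) * u - \<alpha>\<^sup>2 * (1 - q * \<alpha>)) + (1 - \<alpha>) * t) / q"
      using s q_pos by (simp add: zero_le_mult_iff)
    then show ?thesis using q_pos by (simp add: add_divide_distrib)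
  qed
  then have margin: "0 \<le> \<mu> * A * ((1 - \<alpha>\<^sup>2) * u - \<alpha>\<^sup>2 * (1 - q * \<alpha>) + (1 - \<alpha>) * t / q)"
    using \<mu>_pos A_nonneg by simp
  have "0 \<le> (1 - \<alpha>) * \<gamma> * u + (1 - \<alpha>) * M * t * A - A * \<mu> * \<alpha>\<^sup>2 * (1 - q * \<alpha>)"
  proof -
    have "(1 - \<alpha>) * (\<mu> * (1 + \<alpha>) * A) * u \<le> (1 - \<alpha>) * \<gamma> * u"
      using \<alpha> u by (intro mult_right_mono mult_left_mono) (auto simp: \<gamma>_eq)
    moreover have "\<mu> * A * ((1 - \<alpha>\<^sup>2) * u - \<alpha>\<^sup>2 * (1 - q * \<alpha>) + (1 - \<alpha>) * t / q)
      = (1 - \<alpha>) * (\<mu> * (1 + \<alpha>) * A) * u + (1 - \<alpha>) * M * t * A - A * \<mu> * \<alpha>\<^sup>2 * (1 - q * \<alpha>)"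
      using q_pos by (simp add: \<mu>_M field_simps power2_eq_square)
    ultimately show ?thesis using margin by linarith
  qed
  then have "0 \<le> abar\<^sup>2 * ((1 - \<alpha>) * \<gamma> * u + (1 - \<alpha>) * M * t * A - A * \<mu> * \<alpha>\<^sup>2 * (1 - q * \<alpha>))"
    by simp
  also have "\<dots> = u * ((1 - \<alpha>) * \<gamma> * abar\<^sup>2 + A * (\<gamma>' * ((1 - \<alpha>) * a - 2 * q * \<alpha>\<^sup>2 * A') + \<mu> * \<alpha>\<^sup>2 * abar\<^sup>2))"
  proof -
    have sq: "M * abar\<^sup>2 = A' * u * \<gamma>'" using abar_square by (simp add: u_def)
    have "\<mu> * abar\<^sup>2 = q * (A' * u * \<gamma>')" using sq by (simp add: \<mu>_M)
    then have "u * (\<mu> * abar\<^sup>2) = (2 - (1 - q * \<alpha>)) * (\<mu> * abar\<^sup>2)"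
       and h1: "2 * \<mu> * abar\<^sup>2 = 2 * q * A' * u * \<gamma>'" by (simp_all add: u_def algebra_simps)
    have h2: "M * t * abar\<^sup>2 = a * u * \<gamma>'"
      using sq by (simp add: t(3) mult.commute mult.left_commute)
    have "abar\<^sup>2 * ((1 - \<alpha>) * \<gamma> * u + (1 - \<alpha>) * M * t * A - A * \<mu> * \<alpha>\<^sup>2 * (1 - q * \<alpha>))
       = u * (1 - \<alpha>) * \<gamma> * abar\<^sup>2 + (1 - \<alpha>) * A * (M * t * abar\<^sup>2) + A * \<alpha>\<^sup>2 * (u * \<mu> * abar\<^sup>2)
         - A * \<alpha>\<^sup>2 * (2 * \<mu> * abar\<^sup>2)"
      by (simp add: u_def algebra_simps)
    also have "\<dots> = u * ((1 - \<alpha>) * \<gamma> * abar\<^sup>2 + A * (\<gamma>' * ((1 - \<alpha>) * a - 2 * q * \<alpha>\<^sup>2 * A') + \<mu> * \<alpha>\<^sup>2 * abar\<^sup>2))"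
      unfolding h1 h2 by (simp add: algebra_simps)
    finally show ?thesis .
  qed
  finally have "0 \<le> \<mu> * ((1 - \<alpha>) * \<gamma> * abar\<^sup>2 + A * (\<gamma>' * ((1 - \<alpha>) * a - 2 * q * \<alpha>\<^sup>2 * A') + \<mu> * \<alpha>\<^sup>2 * abar\<^sup>2))"
    using u \<mu>_pos by (simp add: zero_le_mult_iff)
  also have "\<dots> = \<mu> * (1 - \<alpha>) * abar\<^sup>2 * \<gamma> + A * (\<gamma>bar\<^sup>2 - \<gamma> * \<gamma>')"
  proof -
    have "\<gamma>bar\<^sup>2 - \<gamma> * \<gamma>' = \<gamma>' * (\<gamma>' - \<gamma>) - 2 * \<mu> * \<alpha> * abar * \<gamma>' + \<mu>\<^sup>2 * \<alpha>\<^sup>2 * abar\<^sup>2"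
      by (simp add: \<gamma>bar_eq algebra_simps power2_eq_square)
    also have "\<gamma>' - \<gamma> = \<mu> * (1 + \<alpha>) * a" using \<gamma>_sum by simp
    also have "\<gamma>' * (\<mu> * (1 + \<alpha>) * a) - 2 * \<mu> * \<alpha> * abar * \<gamma>' + \<mu>\<^sup>2 * \<alpha>\<^sup>2 * abar\<^sup>2
      = \<mu> * (\<gamma>' * ((1 + \<alpha>) * a - 2 * \<alpha> * abar) + \<mu> * \<alpha>\<^sup>2 * abar\<^sup>2)"
      by (simp add: algebra_simps power2_eq_square)
    also have "(1 + \<alpha>) * a - 2 * \<alpha> * abar = (1 - \<alpha>) * a - 2 * q * \<alpha>\<^sup>2 * A'"
      by (simp add: abar_eq algebra_simps power2_eq_square)
    finally have diff: "\<gamma>bar\<^sup>2 - \<gamma> * \<gamma>'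
      = \<mu> * (\<gamma>' * ((1 - \<alpha>) * a - 2 * q * \<alpha>\<^sup>2 * A') + \<mu> * \<alpha>\<^sup>2 * abar\<^sup>2)" .
    show ?thesis unfolding diff by (simp add: algebra_simps)
  qed
  finally have "0 \<le> (\<mu> * (1 - \<alpha>) * abar\<^sup>2 * \<gamma> + A * (\<gamma>bar\<^sup>2 - \<gamma> * \<gamma>')) / (abar\<^sup>2 * \<gamma>)"
    using \<gamma>_ge_1 by (simp add: divide_nonneg_nonneg)
  also have "\<dots> = \<mu> * (1 - \<alpha>) + A * \<gamma>bar\<^sup>2 / (abar\<^sup>2 * \<gamma>) - A * \<gamma>' / abar\<^sup>2"
    using \<gamma>_ge_1 abar_pos by (simp add: field_simps)
  finally show ?thesis using A_nonneg by simp
qed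

text \<open>
  Divided by \<open>sqrt q\<close>, the first term of the margin grows as \<open>q\<close> decreases, so it can be bounded with
  the hypothesis at \<open>ql\<close>. What remains is \<open>1 - \<alpha>\<^sup>2 - ql * \<alpha> * \<alpha>\<^sup>2 + q * \<alpha>\<close>; squaring the hypothesis
  gives \<open>ql * \<alpha>\<^sup>2 \<le> 3 * (1 - \<alpha>)\<^sup>2 * (1 + \<alpha>)\<close>, which makes it nonnegative.
\<close>

lemma progress_margin_nonneg_of_delta:
  assumes q: "0 < q" "q \<le> ql" "ql \<le> 1 / 3" and \<alpha>: "0 \<le> \<alpha>" "\<alpha> \<le> 1"
    and delta: "0 \<le> delta_fun ql \<alpha>"
  shows "0 \<le> progress_margin q \<alpha>"
proof -
  have ql: "0 < ql" using q by simp
  have le1: "ql * \<alpha> \<le> 1 / 3" "ql * \<alpha>\<^sup>2 \<le> 1 / 3" "\<alpha>\<^sup>2 \<le> 1"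
    using q \<alpha> mult_mono[of ql "1/3" \<alpha> 1] mult_mono[of ql "1/3" "\<alpha>\<^sup>2" 1] by (auto simp: power_le_one)
  have d: "sqrt ql * \<alpha> * (1 - ql * \<alpha>\<^sup>2) \<le> (1 - \<alpha>) * sqrt ((1 + \<alpha>) * (1 + ql * \<alpha>))"
    using delta by (simp add: delta_fun_def)
  have "(sqrt ql * \<alpha> * (1 - ql * \<alpha>\<^sup>2))\<^sup>2 \<le> ((1 - \<alpha>) * sqrt ((1 + \<alpha>) * (1 + ql * \<alpha>)))\<^sup>2"
    using d \<alpha> ql le1 by (intro power_mono mult_nonneg_nonneg) auto
  then have sq: "ql * \<alpha>\<^sup>2 * (1 - ql * \<alpha>\<^sup>2)\<^sup>2 \<le> (1 - \<alpha>)\<^sup>2 * ((1 + \<alpha>) * (1 + ql * \<alpha>))"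
    using ql \<alpha> by (simp add: power_mult_distrib)
  have "ql * \<alpha>\<^sup>2 * (2/3)\<^sup>2 \<le> ql * \<alpha>\<^sup>2 * (1 - ql * \<alpha>\<^sup>2)\<^sup>2"
    using le1 ql by (intro mult_left_mono power_mono) auto
  also note sq
  also have "(1 - \<alpha>)\<^sup>2 * ((1 + \<alpha>) * (1 + ql * \<alpha>)) \<le> (1 - \<alpha>)\<^sup>2 * ((1 + \<alpha>) * (4/3))"
    using le1 \<alpha> by (intro mult_left_mono) auto
  finally have "ql * \<alpha>\<^sup>2 \<le> 3 * (1 - \<alpha>)\<^sup>2 * (1 + \<alpha>)" by (simp add: power2_eq_square field_simps)
  then have "\<alpha> * (ql * \<alpha>\<^sup>2) \<le> \<alpha> * (3 * (1 - \<alpha>)\<^sup>2 * (1 + \<alpha>))"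
    using \<alpha> by (intro mult_left_mono) auto
  also have "\<dots> = (3 * (\<alpha> * (1 - \<alpha>))) * ((1 - \<alpha>) * (1 + \<alpha>))"
    by (simp add: power2_eq_square)
  also have "\<dots> \<le> 1 * ((1 - \<alpha>) * (1 + \<alpha>))"
  proof (rule mult_right_mono)
    have "0 \<le> 3 * (\<alpha> - 1/2)\<^sup>2" by simp
    then show "3 * (\<alpha> * (1 - \<alpha>)) \<le> 1" by (simp add: power2_eq_square algebra_simps)
  qed (use \<alpha> in simp)
  finally have cubic: "ql * \<alpha> * \<alpha>\<^sup>2 \<le> 1 - \<alpha>\<^sup>2"
    by (simp add: algebra_simps power2_eq_square)
  have "sqrt q * (\<alpha> * (1 - ql * \<alpha>\<^sup>2)) \<le> (1 - \<alpha>) * sqrt ((1 + \<alpha>) * (1 + q * \<alpha>))"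
  proof -
    have "sqrt ql * (sqrt q * (\<alpha> * (1 - ql * \<alpha>\<^sup>2)))
        = sqrt q * (sqrt ql * \<alpha> * (1 - ql * \<alpha>\<^sup>2))" by simp
    also have "\<dots> \<le> sqrt q * ((1 - \<alpha>) * sqrt ((1 + \<alpha>) * (1 + ql * \<alpha>)))"
      using q d by (intro mult_left_mono) auto
    also have "\<dots> = (1 - \<alpha>) * sqrt (q * ((1 + \<alpha>) * (1 + ql * \<alpha>)))"
      by (simp add: real_sqrt_mult)
    also have "\<dots> \<le> (1 - \<alpha>) * sqrt (ql * ((1 + \<alpha>) * (1 + q * \<alpha>)))"
    proof (intro mult_left_mono real_sqrt_le_mono)
      have "q * (1 + \<alpha>) \<le> ql * (1 + \<alpha>)" using q \<alpha> by (intro mult_right_mono) auto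
      then show "q * ((1 + \<alpha>) * (1 + ql * \<alpha>)) \<le> ql * ((1 + \<alpha>) * (1 + q * \<alpha>))"
        by (simp add: algebra_simps)
    qed (use \<alpha> in simp)
    also have "\<dots> = sqrt ql * ((1 - \<alpha>) * sqrt ((1 + \<alpha>) * (1 + q * \<alpha>)))"
      by (simp add: real_sqrt_mult)
    finally show ?thesis using ql by simp
  qed
  then have "sqrt q * (\<alpha> * (1 - ql * \<alpha>\<^sup>2)) + sqrt q * (1 - \<alpha> - \<alpha>\<^sup>2 + q * \<alpha>) \<le> progress_margin q \<alpha>"
    by (simp add: progress_margin_def)
  moreover have "0 \<le> sqrt q * (1 - \<alpha>\<^sup>2 - ql * \<alpha> * \<alpha>\<^sup>2 + q * \<alpha>)"
    using cubic q \<alpha> by (intro mult_nonneg_nonneg) auto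
  ultimately show ?thesis by (simp add: algebra_simps power2_eq_square)
qed

text \<open>
  The bound \<open>sqrt ((1 + \<alpha>) * (1 + q * \<alpha>)) \<ge> sqrt q * (1 + \<alpha>)\<close> removes the square root. The quadratic
  condition holds up to about 0.78, in particular for 0.7542.
\<close>

lemma progress_margin_nonneg_of_quadratic:
  assumes q: "0 < q" "q \<le> 1" and \<alpha>: "0 \<le> \<alpha>" "\<alpha> \<le> 1" and quad: "2 * \<alpha>\<^sup>2 + \<alpha> \<le> 2"
  shows "0 \<le> progress_margin q \<alpha>"
proof -
  have "sqrt q * (1 + \<alpha>) = sqrt (q * (1 + \<alpha>) * (1 + \<alpha>))"
    using \<alpha> by (simp add: real_sqrt_mult)
  also have "\<dots> \<le> sqrt ((1 + \<alpha>) * (1 + q * \<alpha>))"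
  proof (rule real_sqrt_le_mono)
    have "q * (1 + \<alpha>) * (1 + \<alpha>) \<le> (1 + q * \<alpha>) * (1 + \<alpha>)"
      using q \<alpha> by (intro mult_right_mono) (auto simp: algebra_simps)
    then show "q * (1 + \<alpha>) * (1 + \<alpha>) \<le> (1 + \<alpha>) * (1 + q * \<alpha>)" by (simp add: mult.commute)
  qed
  finally have "(1 - \<alpha>) * (sqrt q * (1 + \<alpha>)) \<le> (1 - \<alpha>) * sqrt ((1 + \<alpha>) * (1 + q * \<alpha>))"
    using \<alpha> by (intro mult_left_mono) auto
  moreover have "0 \<le> sqrt q * (2 - \<alpha> - 2 * \<alpha>\<^sup>2 + q * \<alpha>)"
    using quad q \<alpha> by (intro mult_nonneg_nonneg) auto
  ultimately show ?thesis
    by (simp add: progress_margin_def algebra_simps power2_eq_square)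
qed

text \<open>
  The first term is the square root of a product of two decreasing factors; the term subtracted is
  increasing because \<open>3 * q * \<alpha>\<^sup>2 \<le> 1\<close>, and this is where \<open>q \<le> 1 / 3\<close> is needed.
\<close>

lemma delta_fun_strict_antimono:
  assumes q: "0 \<le> q" "q \<le> 1 / 3" and \<alpha>: "0 \<le> \<alpha>" "\<alpha> < \<beta>" "\<beta> \<le> 1"
  shows "delta_fun q \<beta> < delta_fun q \<alpha>"
proof -
  have S: "(1 - t) * sqrt ((1 + t) * (1 + q * t)) = sqrt ((1 - t\<^sup>2) * ((1 - t) * (1 + q * t)))"
    if "t \<le> 1" for t
  proof -
    have "(1 - t\<^sup>2) * ((1 - t) * (1 + q * t)) = (1 - t)\<^sup>2 * ((1 + t) * (1 + q * t))"
      by (simp add: power2_eq_square algebra_simps)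
    then have "sqrt ((1 - t\<^sup>2) * ((1 - t) * (1 + q * t)))
        = sqrt ((1 - t)\<^sup>2) * sqrt ((1 + t) * (1 + q * t))"
      by (simp only: real_sqrt_mult)
    then show ?thesis using that by simp
  qed
  have "(1 - \<beta>\<^sup>2) * ((1 - \<beta>) * (1 + q * \<beta>)) < (1 - \<alpha>\<^sup>2) * ((1 - \<alpha>) * (1 + q * \<alpha>))"
  proof (rule mult_strict_mono')
    show "1 - \<beta>\<^sup>2 < 1 - \<alpha>\<^sup>2" using \<alpha> by (simp add: power_strict_mono)
    have "0 < (\<beta> - \<alpha>) * (1 - q + q * (\<alpha> + \<beta>))"
      using q \<alpha> by (intro mult_pos_pos add_pos_nonneg mult_nonneg_nonneg) auto
    then show "(1 - \<beta>) * (1 + q * \<beta>) < (1 - \<alpha>) * (1 + q * \<alpha>)"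
      by (simp add: algebra_simps)
    show "0 \<le> 1 - \<beta>\<^sup>2" using \<alpha> by (simp add: power_le_one)
    show "0 \<le> (1 - \<beta>) * (1 + q * \<beta>)" using q \<alpha> by (intro mult_nonneg_nonneg) auto
  qed
  then have "(1 - \<beta>) * sqrt ((1 + \<beta>) * (1 + q * \<beta>)) < (1 - \<alpha>) * sqrt ((1 + \<alpha>) * (1 + q * \<alpha>))"
    using \<alpha> by (simp add: S)
  moreover have "sqrt q * \<alpha> * (1 - q * \<alpha>\<^sup>2) \<le> sqrt q * \<beta> * (1 - q * \<beta>\<^sup>2)"
  proof -
    have "\<alpha>\<^sup>2 + \<alpha> * \<beta> + \<beta>\<^sup>2 \<le> 3"
      using \<alpha> mult_mono[of \<alpha> 1 \<beta> 1] power_le_one[of \<alpha> 2] power_le_one[of \<beta> 2] by simp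
    then have "q * (\<alpha>\<^sup>2 + \<alpha> * \<beta> + \<beta>\<^sup>2) \<le> (1 / 3) * 3" using q \<alpha> by (intro mult_mono) auto
    then have "0 \<le> sqrt q * ((\<beta> - \<alpha>) * (1 - q * (\<alpha>\<^sup>2 + \<alpha> * \<beta> + \<beta>\<^sup>2)))"
      using q \<alpha> by (intro mult_nonneg_nonneg) auto
    then show ?thesis by (simp add: algebra_simps power2_eq_square)
  qed
  ultimately show ?thesis by (simp add: delta_fun_def)
qed

lemma delta_fun_nonneg_below_alpha_max:
  assumes q: "0 < q" "q \<le> 1 / 3" and \<alpha>: "0 \<le> \<alpha>" "\<alpha> \<le> alpha_max q"
  shows "\<alpha> \<le> 1 \<and> 0 \<le> delta_fun q \<alpha>"
proof -
  have "continuous_on {0..1} (delta_fun q)"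
    unfolding delta_fun_def by (intro continuous_intros)
  moreover have "delta_fun q 1 \<le> 0" "0 \<le> delta_fun q 0"
    using q by (simp_all add: delta_fun_def)
  ultimately obtain r where r: "r \<in> {0..1}" "delta_fun q r = 0"
    using IVT2'[of "delta_fun q" 1 0 0] by auto
  have "alpha_max q = r"
    unfolding alpha_max_def
  proof (rule the_equality)
    fix s assume "s \<in> {0..1} \<and> delta_fun q s = 0"
    then show "s = r"
      using delta_fun_strict_antimono[of q s r] delta_fun_strict_antimono[of q r s] q r
      by (cases s r rule: linorder_cases) auto
  qed (use r in blast)
  then show ?thesis
    using delta_fun_strict_antimono[of q \<alpha> r] q r \<alpha> by (cases "\<alpha> = r") auto
qed

section \<open>Quadratic identities for estimate functions\<close>

context spd_form
begin

text \<open>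
  \<open>v'\<close> is the stationary point of a sum of quadratics with total curvature \<open>\<gamma>'\<close>, so expanding the sum
  around \<open>v'\<close> leaves no linear term.
\<close>

lemma quadratic_recentering:
  assumes \<gamma>': "\<gamma>' = \<gamma> + a * \<mu> + c' - c"
    and crit: "\<gamma>' *\<^sub>R v' = \<gamma> *\<^sub>R v + (a * \<mu>) *\<^sub>R y - a *\<^sub>R g + c' *\<^sub>R x' - c *\<^sub>R x"
  defines "Q \<equiv> \<lambda>z. \<gamma> / 2 * ip (z - v) (z - v) + a * (ip g (z - y) + \<mu> / 2 * ip (z - y) (z - y))
      + c' / 2 * ip (z - x') (z - x') - c / 2 * ip (z - x) (z - x)"
  shows "Q z = Q v' + \<gamma>' / 2 * ip (z - v') (z - v')"
proof -
  define d where "d = z - v'"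
  have sq: "ip (z - p) (z - p) = ip (v' - p) (v' - p) + 2 * (ip d v' - ip d p) + ip d d" for p
    by (simp add: d_def ip_expand ip_commute algebra_simps)
  have lin: "ip g (z - y) = ip g (v' - y) + ip d g"
    by (simp add: d_def ip_expand ip_commute algebra_simps)
  have "\<gamma>' * ip d v' = \<gamma> * ip d v + a * \<mu> * ip d y - a * ip d g + c' * ip d x' - c * ip d x"
    using arg_cong[OF crit, of "ip d"] by (simp add: ip_expand)
  then have stat: "\<gamma> * (ip d v' - ip d v) + a * (ip d g + \<mu> * (ip d v' - ip d y))
      + c' * (ip d v' - ip d x') - c * (ip d v' - ip d x) = 0"
    unfolding \<gamma>' by (simp add: algebra_simps)
  have expand: "Q z = Q v' + (\<gamma> + a * \<mu> + c' - c) / 2 * ip d d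
      + (\<gamma> * (ip d v' - ip d v) + a * (ip d g + \<mu> * (ip d v' - ip d y))
      + c' * (ip d v' - ip d x') - c * (ip d v' - ip d x))"
    unfolding Q_def sq lin by (simp add: algebra_simps add_divide_distrib diff_divide_distrib)
  show ?thesis using expand[unfolded stat] by (simp add: \<gamma>' d_def)
qed

text \<open>
  Completing the square in \<open>z\<close>. The choice of \<open>y\<close> on the segment from \<open>x\<close> to \<open>v\<close> makes the product of
  \<open>g\<close> and \<open>x - y\<close> cancel, and the choice of \<open>a\<close> makes the square of \<open>g\<close> cancel, so only the
  residual multiple of the square of \<open>x - y\<close> survives.
\<close>

lemma estimate_increment_nonneg:
  assumes step: "weight_step \<mu> M q \<alpha> A a A' abar \<gamma> \<gamma>' \<gamma>bar"
    and margin: "0 \<le> progress_margin q \<alpha>"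
    and v: "v = y - (A * \<gamma>bar / (abar * \<gamma>)) *\<^sub>R (x - y)"
    and x': "x' = y - (1 / M) *\<^sub>R g"
  shows "0 \<le> A * (1 / (2 * M) * ip g g + ip g (x - y) + \<mu> / 2 * ip (x - y) (x - y))
    + \<gamma> / 2 * ip (z - v) (z - v)
    + a * (1 / (2 * M) * ip g g + ip g (z - y) + \<mu> / 2 * ip (z - y) (z - y))
    + A' * (\<mu> * \<alpha> / 2) * ip (z - x') (z - x') - A * (\<mu> * \<alpha> / 2) * ip (z - x) (z - x)"
    (is "0 \<le> ?R")
proof -
  interpret weight_step \<mu> M q \<alpha> A a A' abar \<gamma> \<gamma>' \<gamma>bar by (rule step)
  define w where "w = z - y"
  define e where "e = x - y"
  define k where "k = A * \<gamma>bar / (abar * \<gamma>)"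
  have zv: "z - v = w + k *\<^sub>R e" by (simp add: v w_def e_def k_def)
  have zx': "z - x' = w + (1 / M) *\<^sub>R g" by (simp add: x' w_def)
  have zx: "z - x = w - e" by (simp add: w_def e_def)
  have nz: "abar \<noteq> 0" "\<gamma> \<noteq> 0" "\<gamma>' \<noteq> 0" "M \<noteq> 0"
    using abar_pos \<gamma>_ge_1 \<gamma>'_ge_1 M_pos by auto
  \<comment> \<open>coefficients of the products of \<open>w\<close>, \<open>g\<close> and \<open>e\<close>, before and after completing the square\<close>
  have cww: "\<gamma> + a * \<mu> + A' * (\<mu> * \<alpha>) - A * (\<mu> * \<alpha>) = \<gamma>'"
    by (simp add: \<gamma>'_eq algebra_simps)
  have cwg: "a + A' * (\<mu> * \<alpha>) / M = abar"
    by (simp add: abar_eq q_eq)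
  have \<gamma>k: "\<gamma> * k = A * \<gamma>bar / abar" using nz by (simp add: k_def)
  have cwe: "\<gamma> * k + A * (\<mu> * \<alpha>) = A * \<gamma>' / abar"
    unfolding \<gamma>k using nz by (simp add: \<gamma>bar_eq field_simps)
  have cgg: "(A + a) / M + A' * (\<mu> * \<alpha>) / M\<^sup>2 = abar\<^sup>2 / \<gamma>'"
  proof -
    have "abar\<^sup>2 / \<gamma>' = A' * (1 + q * \<alpha>) / M"
      using abar_square nz by (simp add: field_simps)
    then show ?thesis
      using nz by (simp add: A'_eq[symmetric] q_eq power2_eq_square field_simps)
  qed
  have cee: "A * \<mu> + \<gamma> * k\<^sup>2 - A * (\<mu> * \<alpha>) = A\<^sup>2 * \<gamma>' / abar\<^sup>2
      + A * (\<mu> * (1 - \<alpha>) + A * \<gamma>bar\<^sup>2 / (abar\<^sup>2 * \<gamma>) - A * \<gamma>' / abar\<^sup>2)"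
    using nz by (simp add: k_def power2_eq_square field_simps)
  have "?R = (\<gamma> + a * \<mu> + A' * (\<mu> * \<alpha>) - A * (\<mu> * \<alpha>)) / 2 * ip w w
      + (a + A' * (\<mu> * \<alpha>) / M) * ip g w + (\<gamma> * k + A * (\<mu> * \<alpha>)) * ip w e + A * ip g e
      + ((A + a) / M + A' * (\<mu> * \<alpha>) / M\<^sup>2) / 2 * ip g g
      + (A * \<mu> + \<gamma> * k\<^sup>2 - A * (\<mu> * \<alpha>)) / 2 * ip e e"
    unfolding zv zx' zx w_def[symmetric] e_def[symmetric]
    by (simp add: ip_expand ip_commute algebra_simps power2_eq_square add_divide_distrib
        diff_divide_distrib)
  also have "\<dots> = \<gamma>' / 2 * ip (w + (abar / \<gamma>') *\<^sub>R g + (A / abar) *\<^sub>R e) (w + (abar / \<gamma>') *\<^sub>R g + (A / abar) *\<^sub>R e)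
      + A * (\<mu> * (1 - \<alpha>) + A * \<gamma>bar\<^sup>2 / (abar\<^sup>2 * \<gamma>) - A * \<gamma>' / abar\<^sup>2) / 2 * ip e e"
    unfolding cww cwg cwe cgg cee using nz
    by (simp add: ip_expand ip_commute distrib_left distrib_right add_divide_distrib
        power2_eq_square mult_ac)
  also have "0 \<le> \<dots>"
    using residual_weight_nonneg[OF margin] \<gamma>'_ge_1 ip_nonneg by (intro add_nonneg_nonneg) auto
  finally show ?thesis .
qed

end

section \<open>Sequences generated by the method\<close>

locale eacgm = composite_problem B f f' \<Psi> Lf \<mu>f \<mu>\<Psi> \<mu> xstar
  for B :: "'a::euclidean_space \<Rightarrow> 'a \<Rightarrow>\<^sub>L real" and f f' \<Psi> Lf \<mu>f \<mu>\<Psi> \<mu> xstar +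
  fixes Ll Lu qu ru rd \<alpha> :: real and L A a \<gamma> :: "nat \<Rightarrow> real" and x y v :: "nat \<Rightarrow> 'a"
  assumes \<mu>_pos: "0 < \<mu>"
    and L0_pos: "0 < L 0" and ru_gt_1: "1 < ru" and rd: "rd \<le> 1"
    and Lu_eq: "Lu = max (rd * L 0) (ru * Lf)"
    and Ll_le: "Ll \<le> Lu"
    and qu_eq: "qu = \<mu> / (Lu + \<mu>\<Psi>)"
    and \<alpha>: "0 \<le> \<alpha>" "\<alpha> \<le> 1"
    and run: "eacgm_run B f f' \<Psi> \<mu>f \<mu>\<Psi> Ll ru rd (\<lambda>_. \<alpha>) L A a \<gamma> x y v"
    and L_gt: "\<And>k. 1 \<le> k \<Longrightarrow> \<mu>f < L k"
begin

abbreviation F :: "'a \<Rightarrow> ereal" where "F \<equiv> objective f \<Psi>"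

definition Lbar :: "nat \<Rightarrow> real" where "Lbar k = L k + \<mu>\<Psi>"

definition tr :: "nat \<Rightarrow> 'a trial" where
  "tr k = eacgm_trial B f f' \<Psi> \<mu>f \<mu>\<Psi> \<alpha> \<alpha> (A k) (\<gamma> k) (x k) (v k) (L (Suc k))"

definition g :: "nat \<Rightarrow> 'a" where "g k = Lbar k *\<^sub>R (y k - x k)"

lemma inv_comp_gradient: "inv B (comp_gradient B \<mu>\<Psi> (L k) (y k) (x k)) = g k"
proof -
  have "comp_gradient B \<mu>\<Psi> (L k) (y k) (x k) = B (g k)"
    using linear_B by (simp add: comp_gradient_def g_def Lbar_def linear_scale)
  then show ?thesis by simp
qed

lemma run_start: "A 0 = 0" "\<gamma> 0 = 1" "v 0 = x 0"
  using run by (simp_all add: eacgm_run_def)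

lemma run_step:
  "a (Suc k) = tr_a (tr k)" "A (Suc k) = tr_A (tr k)" "\<gamma> (Suc k) = tr_gamma (tr k)"
  "y (Suc k) = tr_y (tr k)" "x (Suc k) = tr_x (tr k)"
  "v (Suc k) = (\<gamma> k / tr_gammabar (tr k)) *\<^sub>R v k
     + (1 - \<gamma> k / tr_gammabar (tr k)) *\<^sub>R y (Suc k)
     - (tr_abar (tr k) / \<gamma> (Suc k)) *\<^sub>R g (Suc k)"
  using run by (simp_all add: eacgm_run_def Let_def tr_def flip: inv_comp_gradient)

text \<open>
  A rejected trial estimate is below \<open>Lf\<close>, whatever points it produced: above \<open>Lf\<close> the descent test
  holds for all pairs of points.
\<close>

lemma L_search:
  obtains i where "L (Suc k) = ru ^ i * max Ll (rd * L k)"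
    "descent_test B f f' (L (Suc k)) (y (Suc k)) (x (Suc k))"
    "\<And>j. j < i \<Longrightarrow> ru ^ j * max Ll (rd * L k) < Lf"
proof -
  let ?tr = "eacgm_trial B f f' \<Psi> \<mu>f \<mu>\<Psi> \<alpha> \<alpha> (A k) (\<gamma> k) (x k) (v k)"
  let ?s = "max Ll (rd * L k)"
  obtain i where i: "L (Suc k) = ru ^ i * ?s"
    "descent_test B f f' (ru ^ i * ?s) (tr_y (?tr (ru ^ i * ?s))) (tr_x (?tr (ru ^ i * ?s)))"
    "\<forall>j<i. \<not> descent_test B f f' (ru ^ j * ?s) (tr_y (?tr (ru ^ j * ?s))) (tr_x (?tr (ru ^ j * ?s)))"
    using run unfolding eacgm_run_def Let_def by blast
  have "ru ^ j * ?s < Lf" if "j < i" for j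
    using i(3) that descent_test_passes[of "ru ^ j * ?s"] by (meson not_le)
  then show thesis
    using i(1,2) that[of i] by (simp add: run_step tr_def)
qed

lemma L_pos: "0 < L k"
  using L0_pos L_gt[of k] \<mu>f_nonneg by (cases k) auto

lemma descent: "descent_test B f f' (L (Suc k)) (y (Suc k)) (x (Suc k))"
  by (rule L_search)

lemma L_le_Lu_step:
  assumes "rd * L k \<le> Lu"
  shows "L (Suc k) \<le> Lu"
proof -
  obtain i where i: "L (Suc k) = ru ^ i * max Ll (rd * L k)"
    "\<And>j. j < i \<Longrightarrow> ru ^ j * max Ll (rd * L k) < Lf"
    by (rule L_search) blast
  show ?thesis
  proof (cases i)
    case 0
    then show ?thesis using i(1) assms Ll_le by simp
  next
    case (Suc j)
    then have "L (Suc k) = ru * (ru ^ j * max Ll (rd * L k))" using i(1) by (simp add: mult.assoc)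
    also have "\<dots> \<le> ru * Lf" using i(2)[of j] Suc ru_gt_1 by (intro mult_left_mono) auto
    finally show ?thesis by (simp add: Lu_eq)
  qed
qed

lemma L_le_Lu: "L (Suc k) \<le> Lu"
proof (induction k)
  case 0
  show ?case by (rule L_le_Lu_step) (simp add: Lu_eq)
next
  case (Suc k)
  have "rd * L (Suc k) \<le> 1 * L (Suc k)"
    using rd L_pos[of "Suc k"] by (intro mult_right_mono) auto
  then show ?case using Suc by (intro L_le_Lu_step) simp
qed

definition q :: "nat \<Rightarrow> real" where "q k = \<mu> / Lbar k"

lemma weight_step_of_invariant:
  assumes "0 \<le> A k" "\<gamma> k = 1 + \<mu> * (1 + \<alpha>) * A k"
  shows "weight_step \<mu> (Lbar (Suc k)) (q (Suc k)) \<alpha> (A k) (a (Suc k)) (A (Suc k))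
    (tr_abar (tr k)) (\<gamma> k) (\<gamma> (Suc k)) (tr_gammabar (tr k))"
  using \<mu>_pos \<alpha> assms L_gt[of "Suc k"]
  by unfold_locales
    (simp_all add: run_step tr_def eacgm_trial_def Let_def q_def Lbar_def flip: \<mu>_eq, simp add: \<mu>_eq)

lemma weights_invariant: "0 \<le> A k \<and> \<gamma> k = 1 + \<mu> * (1 + \<alpha>) * A k"
proof (induction k)
  case 0
  show ?case by (simp add: run_start)
next
  case (Suc k)
  then interpret weight_step \<mu> "Lbar (Suc k)" "q (Suc k)" \<alpha> "A k" "a (Suc k)" "A (Suc k)"
    "tr_abar (tr k)" "\<gamma> k" "\<gamma> (Suc k)" "tr_gammabar (tr k)"
    by (intro weight_step_of_invariant) auto
  show ?case using A'_pos \<gamma>'_canonical by simp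
qed

lemma weight_step: "weight_step \<mu> (Lbar (Suc k)) (q (Suc k)) \<alpha> (A k) (a (Suc k)) (A (Suc k))
    (tr_abar (tr k)) (\<gamma> k) (\<gamma> (Suc k)) (tr_gammabar (tr k))"
  using weights_invariant[of k] by (intro weight_step_of_invariant) auto

lemma A_Suc: "A (Suc k) = A k + a (Suc k)"
  using weight_step by (rule weight_step.A'_eq)

lemma A_eq_sum: "A k = (\<Sum>i=1..k. a i)"
  by (induction k) (simp_all add: run_start A_Suc)

lemma Lbar_pos: "0 < Lbar k"
  using L_pos[of k] \<mu>\<Psi>_nonneg by (simp add: Lbar_def)

lemma x_Suc: "x (Suc k) = prox_grad B f f' \<Psi> (L (Suc k)) (y (Suc k))"
  by (simp add: run_step tr_def eacgm_trial_def Let_def)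

lemma x_Suc_gradient: "x (Suc k) = y (Suc k) - (1 / Lbar (Suc k)) *\<^sub>R g (Suc k)"
  using Lbar_pos[of "Suc k"] by (simp add: g_def)

lemma v_relative_to_y:
  "v k = y (Suc k) - (A k * tr_gammabar (tr k) / (tr_abar (tr k) * \<gamma> k)) *\<^sub>R (x k - y (Suc k))"
proof -
  interpret weight_step \<mu> "Lbar (Suc k)" "q (Suc k)" \<alpha> "A k" "a (Suc k)" "A (Suc k)"
    "tr_abar (tr k)" "\<gamma> k" "\<gamma> (Suc k)" "tr_gammabar (tr k)"
    by (rule weight_step)
  define p where "p = A k * tr_gammabar (tr k)"
  define r where "r = tr_abar (tr k) * \<gamma> k"
  have "0 < r" using abar_pos \<gamma>_ge_1 by (simp add: r_def)
  moreover have "0 \<le> p" using A_nonneg \<gamma>bar_ge_1 by (simp add: p_def)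
  ultimately have nz: "p + r \<noteq> 0" "r \<noteq> 0" by auto
  have "y (Suc k) = inverse (p + r) *\<^sub>R (p *\<^sub>R x k + r *\<^sub>R v k)"
    by (simp add: p_def r_def run_step tr_def eacgm_trial_def Let_def)
  then have "(p + r) *\<^sub>R y (Suc k) = p *\<^sub>R x k + r *\<^sub>R v k" using nz by simp
  then have "r *\<^sub>R v k = r *\<^sub>R y (Suc k) - p *\<^sub>R (x k - y (Suc k))"
    by (simp add: algebra_simps)
  then have "(1 / r) *\<^sub>R (r *\<^sub>R v k) = (1 / r) *\<^sub>R (r *\<^sub>R y (Suc k) - p *\<^sub>R (x k - y (Suc k)))" by simp
  then have "v k = y (Suc k) - (p / r) *\<^sub>R (x k - y (Suc k))"
    using nz by (simp add: scaleR_diff_right)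
  then show ?thesis by (simp add: p_def r_def)
qed

text \<open>
  The update of \<open>v\<close> in the method mentions neither \<open>x k\<close> nor \<open>x (k + 1)\<close>; rewriting it relative to
  \<open>y (k + 1)\<close> shows that it is the stationarity condition of the next estimate function.
\<close>

lemma v_Suc_stationary:
  "\<gamma> (Suc k) *\<^sub>R v (Suc k) = \<gamma> k *\<^sub>R v k + (a (Suc k) * \<mu>) *\<^sub>R y (Suc k) - a (Suc k) *\<^sub>R g (Suc k)
    + (A (Suc k) * (\<mu> * \<alpha>)) *\<^sub>R x (Suc k) - (A k * (\<mu> * \<alpha>)) *\<^sub>R x k"
proof -
  let ?abar = "tr_abar (tr k)" and ?\<gamma>bar = "tr_gammabar (tr k)"
  interpret weight_step \<mu> "Lbar (Suc k)" "q (Suc k)" \<alpha> "A k" "a (Suc k)" "A (Suc k)"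
    ?abar "\<gamma> k" "\<gamma> (Suc k)" ?\<gamma>bar
    by (rule weight_step)
  define e where "e = x k - y (Suc k)"
  have nz: "?abar \<noteq> 0" "\<gamma> k \<noteq> 0" "\<gamma> (Suc k) \<noteq> 0" "?\<gamma>bar \<noteq> 0"
    using abar_pos \<gamma>_ge_1 \<gamma>'_ge_1 \<gamma>bar_ge_1 by auto
  have x: "x k = y (Suc k) + e" by (simp add: e_def)
  have v: "v k = y (Suc k) - (A k * ?\<gamma>bar / (?abar * \<gamma> k)) *\<^sub>R e"
    using v_relative_to_y[of k] by (simp add: e_def)
  have "\<gamma> (Suc k) *\<^sub>R v (Suc k)
      = \<gamma> (Suc k) *\<^sub>R y (Suc k) - (A k * \<gamma> (Suc k) / ?abar) *\<^sub>R e - ?abar *\<^sub>R g (Suc k)"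
  proof -
    have "v (Suc k) = y (Suc k) - (\<gamma> k / ?\<gamma>bar * (A k * ?\<gamma>bar / (?abar * \<gamma> k))) *\<^sub>R e
        - (?abar / \<gamma> (Suc k)) *\<^sub>R g (Suc k)"
      unfolding run_step(6) v by (simp add: algebra_simps)
    also have "\<gamma> k / ?\<gamma>bar * (A k * ?\<gamma>bar / (?abar * \<gamma> k)) = A k / ?abar"
      using nz by simp
    finally show ?thesis using nz by (simp add: scaleR_diff_right mult.commute)
  qed
  also have "\<dots> = (\<gamma> k + a (Suc k) * \<mu> + A (Suc k) * (\<mu> * \<alpha>) - A k * (\<mu> * \<alpha>)) *\<^sub>R y (Suc k)
      - (A k * ?\<gamma>bar / ?abar + A k * (\<mu> * \<alpha>)) *\<^sub>R e
      - (a (Suc k) + A (Suc k) * (\<mu> * \<alpha>) / Lbar (Suc k)) *\<^sub>R g (Suc k)"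
  proof -
    have "\<gamma> k + a (Suc k) * \<mu> + A (Suc k) * (\<mu> * \<alpha>) - A k * (\<mu> * \<alpha>) = \<gamma> (Suc k)"
      by (simp add: \<gamma>'_eq algebra_simps)
    moreover have "A k * ?\<gamma>bar / ?abar + A k * (\<mu> * \<alpha>) = A k * \<gamma> (Suc k) / ?abar"
      using nz by (simp add: \<gamma>bar_eq field_simps)
    moreover have "a (Suc k) + A (Suc k) * (\<mu> * \<alpha>) / Lbar (Suc k) = ?abar"
      by (simp add: abar_eq q_eq)
    ultimately show ?thesis by simp
  qed
  also have "\<dots> = \<gamma> k *\<^sub>R v k + (a (Suc k) * \<mu>) *\<^sub>R y (Suc k) - a (Suc k) *\<^sub>R g (Suc k)
    + (A (Suc k) * (\<mu> * \<alpha>)) *\<^sub>R x (Suc k) - (A k * (\<mu> * \<alpha>)) *\<^sub>R x k"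
    unfolding x_Suc_gradient v x using nz by (simp add: algebra_simps)
  finally show ?thesis .
qed

section \<open>Estimate functions\<close>

text \<open>
  Real-valued versions of the estimate functions. The value of \<open>Fx 0\<close> is arbitrary when the
  objective is infinite at the starting point; it only occurs multiplied by \<open>A 0 = 0\<close>.
\<close>

definition Fx :: "nat \<Rightarrow> real" where "Fx k = real_of_ereal (F (x k))"

definition lower_model :: "nat \<Rightarrow> 'a \<Rightarrow> real" where
  "lower_model i z = Fx i + (1 / (2 * Lbar i) * ip (g i) (g i) + ip (g i) (z - y i) + \<mu> / 2 * ip (z - y i) (z - y i))"

definition estimate :: "nat \<Rightarrow> 'a \<Rightarrow> real" where
  "estimate k z = (\<Sum>i=1..k. a i * lower_model i z)
     + (A k * (\<mu> * \<alpha> / 2) * ip (z - x k) (z - x k) + 1 / 2 * ip (z - x 0) (z - x 0))"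

lemma F_x_Suc: "F (x (Suc k)) = ereal (Fx (Suc k))"
proof -
  obtain p where "\<Psi> (x (Suc k)) = ereal p"
    using \<Psi>_prox_grad_finite[OF L_pos] unfolding x_Suc by blast
  then show ?thesis by (simp add: Fx_def objective_def)
qed

lemma estimate_fun_eq: "estimate_fun B F \<mu>f \<mu>\<Psi> (\<lambda>_. \<alpha>) L A a \<gamma> x y k z = ereal (estimate k z)"
proof -
  have "lower_bound_fun B F \<mu>f \<mu>\<Psi> (L i) (x i) (y i) z = ereal (lower_model i z)" if i: "i \<in> {1..k}" for i
  proof -
    obtain j where j: "i = Suc j" using i by (cases i) auto
    have "(dual_norm B (comp_gradient B \<mu>\<Psi> (L i) (y i) (x i)))\<^sup>2 = ip (g i) (g i)"
      and "comp_gradient B \<mu>\<Psi> (L i) (y i) (x i) (z - y i) = ip (g i) (z - y i)"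
      using inv_comp_gradient[of i] ip_nonneg[of "g i"] B_inv_B[of "comp_gradient B \<mu>\<Psi> (L i) (y i) (x i)"]
      by (simp_all add: dual_norm_def ip_def)
    then show ?thesis
      by (simp add: lower_bound_fun_def Let_def lower_model_def primal_norm_sq F_x_Suc j Lbar_def flip: \<mu>_eq)
  qed
  then show ?thesis
    by (simp add: estimate_fun_def estimate_def primal_norm_sq run_start sum_ereal flip: \<mu>_eq)
qed

lemma estimate_Suc: "estimate (Suc k) z = estimate k z + a (Suc k) * lower_model (Suc k) z
    + A (Suc k) * (\<mu> * \<alpha> / 2) * ip (z - x (Suc k)) (z - x (Suc k))
    - A k * (\<mu> * \<alpha> / 2) * ip (z - x k) (z - x k)"
  by (simp add: estimate_def)

lemma estimate_canonical: "estimate k z = estimate k (v k) + \<gamma> k / 2 * ip (z - v k) (z - v k)"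
proof (induction k arbitrary: z)
  case 0
  show ?case by (simp add: estimate_def run_start ip_expand)
next
  case (Suc k)
  have \<gamma>: "\<gamma> (Suc k) = \<gamma> k + a (Suc k) * \<mu> + A (Suc k) * (\<mu> * \<alpha>) - A k * (\<mu> * \<alpha>)"
    using weight_step.\<gamma>'_eq[OF weight_step, of k] by (simp add: algebra_simps)
  define c where "c = estimate k (v k) + a (Suc k) * (Fx (Suc k) + 1 / (2 * Lbar (Suc k)) * ip (g (Suc k)) (g (Suc k)))"
  have form: "estimate (Suc k) z = c + (\<gamma> k / 2 * ip (z - v k) (z - v k)
      + a (Suc k) * (ip (g (Suc k)) (z - y (Suc k)) + \<mu> / 2 * ip (z - y (Suc k)) (z - y (Suc k)))
      + A (Suc k) * (\<mu> * \<alpha>) / 2 * ip (z - x (Suc k)) (z - x (Suc k))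
      - A k * (\<mu> * \<alpha>) / 2 * ip (z - x k) (z - x k))" for z
    unfolding estimate_Suc Suc[of z] by (simp add: c_def lower_model_def distrib_left add_ac)
  show ?case
    using quadratic_recentering[OF \<gamma> v_Suc_stationary, of z] unfolding form by simp
qed


lemma lower_model_le_objective:
  assumes "F w = ereal Fw"
  shows "lower_model (Suc k) w \<le> Fw"
proof -
  have "1 / (2 * Lbar (Suc k)) * ip (g (Suc k)) (g (Suc k))
      = Lbar (Suc k) / 2 * ip (y (Suc k) - x (Suc k)) (y (Suc k) - x (Suc k))"
    using Lbar_pos[of "Suc k"] by (simp add: g_def ip_expand(7,8))
  moreover have "ip (g (Suc k)) (w - y (Suc k))
      = Lbar (Suc k) * ip (y (Suc k) - x (Suc k)) (w - y (Suc k))"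
    by (simp add: g_def ip_expand(7,8))
  ultimately have "lower_model (Suc k) w = Fx (Suc k)
      + Lbar (Suc k) / 2 * ip (y (Suc k) - x (Suc k)) (y (Suc k) - x (Suc k))
      + Lbar (Suc k) * ip (y (Suc k) - x (Suc k)) (w - y (Suc k))
      + \<mu> / 2 * ip (w - y (Suc k)) (w - y (Suc k))"
    by (simp only: lower_model_def add.assoc)
  then show ?thesis
    using objective_lower_bound[OF L_pos x_Suc descent F_x_Suc assms] by (simp add: Lbar_def)
qed

lemma q_bounds: "0 < q (Suc k)" "q (Suc k) < 1"
  using weight_step.q_pos[OF weight_step] weight_step.q_less_1[OF weight_step] by auto

lemma estimate_sequence_if_margin:
  assumes "\<And>k. 0 \<le> progress_margin (q (Suc k)) \<alpha>"
  shows "A k * Fx k \<le> estimate k z"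
proof (induction k arbitrary: z)
  case 0
  show ?case using ip_nonneg by (simp add: estimate_def run_start)
next
  case (Suc k)
  define P where "P w = 1 / (2 * Lbar (Suc k)) * ip (g (Suc k)) (g (Suc k))
      + ip (g (Suc k)) (w - y (Suc k)) + \<mu> / 2 * ip (w - y (Suc k)) (w - y (Suc k))" for w
  have W: "lower_model (Suc k) w = Fx (Suc k) + P w" for w by (simp add: lower_model_def P_def)
  have "0 \<le> A k * P (x k) + \<gamma> k / 2 * ip (z - v k) (z - v k) + a (Suc k) * P z
    + A (Suc k) * (\<mu> * \<alpha> / 2) * ip (z - x (Suc k)) (z - x (Suc k))
    - A k * (\<mu> * \<alpha> / 2) * ip (z - x k) (z - x k)"
    unfolding P_def
    by (rule estimate_increment_nonneg[OF weight_step assms v_relative_to_y x_Suc_gradient])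
  moreover have "A k * lower_model (Suc k) (x k) \<le> A k * Fx k"
  proof (cases k)
    case (Suc j)
    then show ?thesis
      using lower_model_le_objective[OF F_x_Suc[of j], of k] weights_invariant[of k]
      by (intro mult_left_mono) auto
  qed (simp add: run_start)
  moreover have "A k * Fx k + \<gamma> k / 2 * ip (z - v k) (z - v k) \<le> estimate k z"
    using Suc[of "v k"] estimate_canonical[of k z] by simp
  moreover have "A (Suc k) * Fx (Suc k) = A k * Fx (Suc k) + a (Suc k) * Fx (Suc k)"
    by (simp add: A_Suc distrib_right)
  ultimately show ?case
    unfolding estimate_Suc W distrib_left by linarith
qed

lemma estimate_property_if_margin:
  assumes "\<And>k. 0 \<le> progress_margin (q (Suc k)) \<alpha>"
  shows "estimate_property B F \<mu>f \<mu>\<Psi> (\<lambda>_. \<alpha>) L A a \<gamma> x y"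
  unfolding estimate_property_def estimate_fun_eq
proof (intro allI INF_greatest)
  fix k z
  have "ereal (A k) * F (x k) = ereal (A k * Fx k)"
  proof (cases k)
    case (Suc j)
    then show ?thesis by (simp add: F_x_Suc)
  qed (simp add: run_start zero_ereal_def[symmetric])
  then show "ereal (A k) * F (x k) \<le> ereal (estimate k z)"
    using estimate_sequence_if_margin[OF assms] by simp
qed

text \<open>
  The canonical form of the estimate function at \<open>xstar\<close> contains the wanted distance. The extra term
  with weight \<open>A k * \<mu> * \<alpha> / 2\<close> is paid for by the growth \<open>\<mu> / 2\<close> of the objective away from its
  minimizer, since \<open>\<alpha> \<le> 1\<close>.
\<close>

lemma distance_if_estimate_property:
  assumes "estimate_property B F \<mu>f \<mu>\<Psi> (\<lambda>_. \<alpha>) L A a \<gamma> x y"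
  shows "\<gamma> (Suc k) * ip (v (Suc k) - xstar) (v (Suc k) - xstar) \<le> ip (x 0 - xstar) (x 0 - xstar)"
proof -
  let ?k = "Suc k"
  obtain p where "\<Psi> xstar = ereal p" using \<Psi>_xstar_finite by blast
  moreover define Fs where "Fs = f xstar + p"
  ultimately have Fs: "F xstar = ereal Fs" by (simp add: objective_def)
  have "ereal (A ?k) * F (x ?k) \<le> (INF z. ereal (estimate ?k z))"
    using assms unfolding estimate_property_def estimate_fun_eq by blast
  also have "\<dots> \<le> ereal (estimate ?k (v ?k))" by (rule INF_lower) simp
  finally have v: "A ?k * Fx ?k \<le> estimate ?k (v ?k)" by (simp add: F_x_Suc)
  have sym: "ip (p - r) (p - r) = ip (r - p) (r - p)" for p r
    by (simp add: ip_expand ip_commute)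
  have a_nonneg: "0 \<le> a i" if "i \<in> {1..?k}" for i
    using that weight_step.a_pos[OF weight_step, of "i - 1"] by simp
  have "(\<Sum>i=1..?k. a i * lower_model i xstar) \<le> (\<Sum>i=1..?k. a i * Fs)"
  proof (intro sum_mono mult_left_mono a_nonneg)
    fix i assume "i \<in> {1..?k}"
    then show "lower_model i xstar \<le> Fs"
      using lower_model_le_objective[OF Fs, of "i - 1"] by simp
  qed
  then have "estimate ?k xstar \<le> A ?k * Fs + A ?k * (\<mu> * \<alpha> / 2) * ip (x ?k - xstar) (x ?k - xstar)
      + 1 / 2 * ip (x 0 - xstar) (x 0 - xstar)"
    unfolding estimate_def A_eq_sum[of ?k] sum_distrib_right by (simp add: sym[of xstar])
  moreover have "A ?k * (Fs + \<mu> * \<alpha> / 2 * ip (x ?k - xstar) (x ?k - xstar)) \<le> A ?k * Fx ?k"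
  proof (intro mult_left_mono)
    have "\<alpha> * (\<mu> / 2 * ip (x ?k - xstar) (x ?k - xstar)) \<le> 1 * (\<mu> / 2 * ip (x ?k - xstar) (x ?k - xstar))"
      using \<alpha> \<mu>_pos ip_nonneg by (intro mult_right_mono) auto
    then show "Fs + \<mu> * \<alpha> / 2 * ip (x ?k - xstar) (x ?k - xstar) \<le> Fx ?k"
      using objective_growth[OF Fs F_x_Suc[of k]] by (simp add: mult_ac)
  qed (use weights_invariant in simp)
  moreover note v estimate_canonical[of ?k xstar]
  ultimately show ?thesis by (simp add: sym[of xstar] algebra_simps)
qed

lemma qu_bounds: "0 < qu" "qu \<le> q (Suc k)"
proof -
  have "0 < L (Suc k) + \<mu>\<Psi>" "L (Suc k) + \<mu>\<Psi> \<le> Lu + \<mu>\<Psi>"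
    using L_pos[of "Suc k"] L_le_Lu[of k] \<mu>\<Psi>_nonneg by auto
  then show "0 < qu" "qu \<le> q (Suc k)"
    using \<mu>_pos unfolding qu_eq q_def Lbar_def by (auto intro!: divide_left_mono)
qed

lemma rate_le_ratio: "rate qu \<alpha> * sqrt qu \<le> a (Suc k) / A (Suc k)"
proof -
  interpret weight_step \<mu> "Lbar (Suc k)" "q (Suc k)" \<alpha> "A k" "a (Suc k)" "A (Suc k)"
    "tr_abar (tr k)" "\<gamma> k" "\<gamma> (Suc k)" "tr_gammabar (tr k)"
    by (rule weight_step)
  show ?thesis
    using qu_bounds(1) qu_bounds(2)[of k] \<alpha> ratio_quadratic a_pos A'_pos A_nonneg
    by (intro rate_times_sqrt_le[of qu "q (Suc k)"]) (auto simp: A_Suc)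
qed

text \<open>
  The contraction factor bounds \<open>A k / A (k + 1)\<close>. The first step starts from \<open>A 0 = 0\<close> and instead
  contributes \<open>A 1 \<ge> 1 / (Lu - \<mu>f)\<close>, so the power counts one step less than the weight.
\<close>

lemma A_growth: "1 \<le> (Lu - \<mu>f) * (A (Suc k) * (1 - rate qu \<alpha> * sqrt qu) ^ k)"
proof (induction k)
  case 0
  have "1 / (Lbar (Suc 0) - \<mu>) \<le> A (Suc 0)"
    using weight_step.a_lower[OF weight_step, of 0] by (simp add: A_Suc run_start)
  moreover have "Lbar (Suc 0) - \<mu> = L (Suc 0) - \<mu>f" by (simp add: Lbar_def \<mu>_eq)
  moreover have "0 < L (Suc 0) - \<mu>f" using L_gt[of "Suc 0"] by simp
  ultimately have "1 \<le> (L (Suc 0) - \<mu>f) * A (Suc 0)" by (simp add: field_simps)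
  also have "\<dots> \<le> (Lu - \<mu>f) * A (Suc 0)"
    using L_le_Lu[of 0] weights_invariant by (intro mult_right_mono) auto
  finally show ?case by simp
next
  case (Suc k)
  let ?\<rho> = "rate qu \<alpha> * sqrt qu"
  have A_pos: "0 < A (Suc j)" for j using weight_step.A'_pos[OF weight_step] .
  have "?\<rho> * A (Suc (Suc k)) \<le> a (Suc (Suc k))"
    using rate_le_ratio[of "Suc k"] A_pos[of "Suc k"] by (simp add: field_simps)
  then have contraction: "A (Suc k) \<le> A (Suc (Suc k)) * (1 - ?\<rho>)"
    by (simp add: A_Suc[of "Suc k"] algebra_simps)
  \<comment> \<open>positivity of the contraction factor comes for free from that of the weights\<close>
  then have "0 < A (Suc (Suc k)) * (1 - ?\<rho>)" using A_pos[of k] by simp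
  then have "0 \<le> 1 - ?\<rho>" using A_pos[of "Suc k"] by (simp add: zero_less_mult_iff)
  moreover have "0 \<le> Lu - \<mu>f" using L_le_Lu[of 0] L_gt[of "Suc 0"] by simp
  ultimately have "(Lu - \<mu>f) * (A (Suc k) * (1 - ?\<rho>) ^ k)
      \<le> (Lu - \<mu>f) * (A (Suc (Suc k)) * (1 - ?\<rho>) * (1 - ?\<rho>) ^ k)"
    using contraction by (intro mult_left_mono mult_right_mono) auto
  with Suc show ?case by (simp add: mult_ac)
qed

lemma distance_bound:
  assumes "estimate_property B F \<mu>f \<mu>\<Psi> (\<lambda>_. \<alpha>) L A a \<gamma> x y"
  shows "ip (v (Suc k) - xstar) (v (Suc k) - xstar)
    \<le> (Lu - \<mu>f) / (\<mu> * (1 + \<alpha>)) * (1 - rate qu \<alpha> * sqrt qu) ^ k * ip (x 0 - xstar) (x 0 - xstar)"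
proof -
  define D where "D = ip (v (Suc k) - xstar) (v (Suc k) - xstar)"
  define D0 where "D0 = ip (x 0 - xstar) (x 0 - xstar)"
  define r where "r = (1 - rate qu \<alpha> * sqrt qu) ^ k"
  have A_pos: "0 < A (Suc k)" using weight_step.A'_pos[OF weight_step] .
  have c_pos: "0 < \<mu> * (1 + \<alpha>)" using \<mu>_pos \<alpha> by simp
  have "\<mu> * (1 + \<alpha>) * A (Suc k) * D \<le> \<gamma> (Suc k) * D"
    using weights_invariant[of "Suc k"] ip_nonneg by (intro mult_right_mono) (auto simp: D_def)
  also have "\<dots> \<le> 1 * D0"
    using distance_if_estimate_property[OF assms, of k] by (simp add: D_def D0_def)
  also have "\<dots> \<le> ((Lu - \<mu>f) * (A (Suc k) * r)) * D0"
    using A_growth[of k] ip_nonneg unfolding D0_def r_def by (intro mult_right_mono) auto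
  finally have "A (Suc k) * (\<mu> * (1 + \<alpha>) * D) \<le> A (Suc k) * ((Lu - \<mu>f) * r * D0)"
    by (simp add: mult_ac)
  then have "\<mu> * (1 + \<alpha>) * D \<le> (Lu - \<mu>f) * r * D0" using A_pos by simp
  then have "D \<le> (Lu - \<mu>f) * r * D0 / (\<mu> * (1 + \<alpha>))"
    using c_pos by (simp add: pos_le_divide_eq mult.commute)
  then show ?thesis by (simp add: D_def D0_def r_def)
qed

end

section \<open>The convergence theorem\<close>

theorem mainTheorem3:
  fixes B :: "'a::euclidean_space \<Rightarrow> 'a \<Rightarrow>\<^sub>L real"
    and f :: "'a \<Rightarrow> real" and f' :: "'a \<Rightarrow> 'a \<Rightarrow>\<^sub>L real" and \<Psi> :: "'a \<Rightarrow> ereal"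
    and Lf \<mu>f \<mu>\<Psi> \<mu> Ll Lu qu ru rd \<alpha> :: real
    and L A a \<gamma> :: "nat \<Rightarrow> real" and x y v :: "nat \<Rightarrow> 'a" and xstar :: 'a
  assumes "spd_operator B"
    and "\<And>z. (f has_derivative blinfun_apply (f' z)) (at z)"
    and "0 < Lf"
    and "\<And>z w. dual_norm B (f' z - f' w) \<le> Lf * primal_norm B (z - w)"
    and "0 \<le> \<mu>f"
    and "convex_on UNIV (\<lambda>z. f z - \<mu>f / 2 * (primal_norm B z)\<^sup>2)"
    and "proper_ext \<Psi>" and "lsc \<Psi>"
    and "0 \<le> \<mu>\<Psi>"
    and "convex_ext (\<lambda>z. \<Psi> z - ereal (\<mu>\<Psi> / 2 * (primal_norm B z)\<^sup>2))"
    and "\<mu> = \<mu>f + \<mu>\<Psi>" and "0 < \<mu>"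
    and "\<And>z. objective f \<Psi> xstar \<le> objective f \<Psi> z"
    and "0 < L 0" and "1 < ru" and "0 < rd" and "rd \<le> 1"
    and "Lu = max (rd * L 0) (ru * Lf)"
    and "0 \<le> Ll" and "Ll \<le> Lu"
    and "qu = \<mu> / (Lu + \<mu>\<Psi>)"
    and "0 \<le> \<alpha>" and "\<alpha> \<le> 1"
    and "eacgm_run B f f' \<Psi> \<mu>f \<mu>\<Psi> Ll ru rd (\<lambda>_. \<alpha>) L A a \<gamma> x y v"
    and "\<And>k. 1 \<le> k \<Longrightarrow> \<mu>f < L k"
  shows "(estimate_property B (objective f \<Psi>) \<mu>f \<mu>\<Psi> (\<lambda>_. \<alpha>) L A a \<gamma> x y \<longrightarrow>
            (\<forall>k\<ge>1. (primal_norm B (v k - xstar))\<^sup>2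
               \<le> (Lu - \<mu>f) / (\<mu> * (1 + \<alpha>)) * (1 - rate qu \<alpha> * sqrt qu) ^ (k - 1)
                 * (primal_norm B (x 0 - xstar))\<^sup>2))
       \<and> (((\<forall>k\<ge>1. Ll \<le> L k) \<and> 0 < Ll \<and> \<mu> / (Ll + \<mu>\<Psi>) \<le> 1 / 3 \<and> \<alpha> \<le> alpha_max (\<mu> / (Ll + \<mu>\<Psi>)))
            \<or> \<alpha> = 0.7542
          \<longrightarrow> estimate_property B (objective f \<Psi>) \<mu>f \<mu>\<Psi> (\<lambda>_. \<alpha>) L A a \<gamma> x y)"
proof -
  interpret run: eacgm B f f' \<Psi> Lf \<mu>f \<mu>\<Psi> \<mu> xstar Ll Lu qu ru rd \<alpha> L A a \<gamma> x y v
    using assms by unfold_locales auto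
  show ?thesis
  proof (intro conjI impI allI)
    fix k :: nat
    assume est: "estimate_property B (objective f \<Psi>) \<mu>f \<mu>\<Psi> (\<lambda>_. \<alpha>) L A a \<gamma> x y" and "1 \<le> k"
    then obtain j where "k = Suc j" by (cases k) auto
    then show "(primal_norm B (v k - xstar))\<^sup>2
        \<le> (Lu - \<mu>f) / (\<mu> * (1 + \<alpha>)) * (1 - rate qu \<alpha> * sqrt qu) ^ (k - 1)
          * (primal_norm B (x 0 - xstar))\<^sup>2"
      using run.distance_bound[OF est, of j] by (simp add: run.primal_norm_sq)
  next
    assume params: "((\<forall>k\<ge>1. Ll \<le> L k) \<and> 0 < Ll \<and> \<mu> / (Ll + \<mu>\<Psi>) \<le> 1 / 3 \<and> \<alpha> \<le> alpha_max (\<mu> / (Ll + \<mu>\<Psi>)))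
            \<or> \<alpha> = 0.7542"
    show "estimate_property B (objective f \<Psi>) \<mu>f \<mu>\<Psi> (\<lambda>_. \<alpha>) L A a \<gamma> x y"
    proof (rule run.estimate_property_if_margin)
      fix k
      from params show "0 \<le> progress_margin (run.q (Suc k)) \<alpha>"
      proof
        let ?ql = "\<mu> / (Ll + \<mu>\<Psi>)"
        assume a: "(\<forall>k\<ge>1. Ll \<le> L k) \<and> 0 < Ll \<and> ?ql \<le> 1 / 3 \<and> \<alpha> \<le> alpha_max ?ql"
        have "0 < ?ql" using a assms(9,12) by simp
        then have "0 \<le> delta_fun ?ql \<alpha>"
          using delta_fun_nonneg_below_alpha_max[of ?ql \<alpha>] a assms(22) by simp
        moreover have "run.q (Suc k) \<le> ?ql"
          using a assms(9,12) run.Lbar_pos[of "Suc k"] unfolding run.q_def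
          by (intro divide_left_mono) (auto simp: run.Lbar_def)
        ultimately show ?thesis
          using run.q_bounds[of k] a assms(22,23) by (intro progress_margin_nonneg_of_delta[of _ ?ql]) auto
      next
        assume "\<alpha> = 0.7542"
        then have "2 * \<alpha>\<^sup>2 + \<alpha> \<le> 2" by (simp only:) (simp add: power2_eq_square)
        then show ?thesis
          using run.q_bounds[of k] assms(22,23)
          by (intro progress_margin_nonneg_of_quadratic) auto
      qed
    qed
  qed
qed

end
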